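(* Let $n$ be a positive integer. (1) For every $d\le\sqrt{n}$ there exists a $(d,\delta)$-LPHS $h:\{0,1\}^n\to\mathbb{Z}_n$ with $\delta=\tilde O(d^{-2})$. (2) There exists a $(d,\delta)$-LPHS $h:\{0,1\}^n\to\mathbb{Z}_n$ with $d=\tilde O(\sqrt{n})$ and $\delta=n^{-\omega(1)}$. Furthermore, both the error bound $\delta=\tilde O(d^{-2})$ in (1) and the query bound $d=\tilde O(n^{1/2})$ in (2) are optimal up to polylogarithmic factors.
   Context: For $x\in\{0,1\}^n$ with entries indexed by $\mathbb{Z}_n$, $x\ll 1$ denotes the cyclic shift of $x$ by one position to the left, i.e. $(x\ll 1)[i]=x[i+1 \bmod n]$. A function $h:\{0,1\}^n\to\mathbb{Z}_n$ is a $(d,\delta)$ locality-preserving hash function for shifts (LPHS) if (a) $h$ can be computed by adaptively querying $d$ bits of its input, and (b) $\Pr_x[h(x)\neq h(x\ll 1)+1]\le\delta$ for $x$ uniform in $\{0,1\}^n$ (addition in $\mathbb{Z}_n$). The function $h$ may be randomized, with the same randomness used in the evaluations on $x$ and on $x\ll 1$, in which case the probability is also over this randomness. $\tilde O$ hides polylogarithmic factors in $n$. *)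

theory Defs
  imports "HOL-Probability.Probability" "HOL-Library.Landau_Symbols"
begin

definition bitstrings :: "nat \<Rightarrow> bool list set" where
  "bitstrings n = {x. length x = n}"

text \<open>
  Adaptive bit queries are modelled by decision trees: \<open>Query i l r\<close> reads bit \<open>i\<close> and
  continues with \<open>l\<close> if it is 0 and with \<open>r\<close> if it is 1.
\<close>

datatype 'a dtree = Output 'a | Query nat "'a dtree" "'a dtree"

primrec eval_tree :: "'a dtree \<Rightarrow> bool list \<Rightarrow> 'a" where
  "eval_tree (Output a) x = a"
| "eval_tree (Query i l r) x = (if x ! i then eval_tree r x else eval_tree l x)"

primrec query_depth :: "'a dtree \<Rightarrow> nat" where
  "query_depth (Output a) = 0"
| "query_depth (Query i l r) = Suc (max (query_depth l) (query_depth r))"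

primrec queried :: "'a dtree \<Rightarrow> nat set" where
  "queried (Output a) = {}"
| "queried (Query i l r) = insert i (queried l \<union> queried r)"

definition query_computable :: "nat \<Rightarrow> nat \<Rightarrow> (bool list \<Rightarrow> 'a) \<Rightarrow> bool" where
  "query_computable n d h \<longleftrightarrow>
     (\<exists>t. query_depth t \<le> d \<and> queried t \<subseteq> {..<n} \<and> (\<forall>x\<in>bitstrings n. h x = eval_tree t x))"

text \<open>
  The group of integers modulo \<open>n\<close> is \<open>{..<n}\<close> with addition modulo \<open>n\<close>, and the cyclic left
  shift by one position is \<^const>\<open>rotate1\<close>: bit \<open>i\<close> of \<open>rotate1 x\<close> is bit \<open>Suc i mod n\<close> of \<open>x\<close>
  (lemma \<open>nth_rotate1\<close>).

  A randomized hash function is a distribution \<open>H\<close> on functions; drawing one \<open>h\<close> and evaluating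
  it on both strings expresses that the randomness is shared. As there are only finitely many
  functions on \<open>bitstrings n\<close> with values in \<open>{..<n}\<close>, discrete distributions are no restriction.
  A deterministic hash function \<open>h\<close> is the point mass \<open>return_pmf h\<close>.
\<close>

definition lphs :: "nat \<Rightarrow> nat \<Rightarrow> real \<Rightarrow> (bool list \<Rightarrow> nat) pmf \<Rightarrow> bool" where
  "lphs n d \<delta> H \<longleftrightarrow>
     (\<forall>h\<in>set_pmf H. h \<in> bitstrings n \<rightarrow> {..<n} \<and> query_computable n d h) \<and>
     measure_pmf.prob (pair_pmf H (pmf_of_set (bitstrings n)))
       {(h, x). h x \<noteq> (h (rotate1 x) + 1) mod n} \<le> \<delta>"

definition polylog :: "(nat \<Rightarrow> real) \<Rightarrow> bool" where
  "polylog p \<longleftrightarrow> (\<exists>k::nat. p \<in> O(\<lambda>n. ln (real n) ^ k))"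

text \<open>The condition that \<open>\<delta> n\<close> is bounded by \<open>n\<close> to the power \<open>-\<omega>(1)\<close>:\<close>

definition superpoly_small :: "(nat \<Rightarrow> real) \<Rightarrow> bool" where
  "superpoly_small \<delta> \<longleftrightarrow>
     (\<exists>w. filterlim w at_top sequentially \<and>
          (\<forall>\<^sub>F n in sequentially. \<delta> n \<le> real n powr (- w n)))"

end

theory Submission
  imports Defs "HOL-Real_Asymp.Real_Asymp"
begin

text \<open>
  Label every position by the window of \<open>k\<close> bits starting there. For almost all \<open>x\<close> these windows are
  distinct, so a random function of windows gives independent values at distinct positions, and the
  randomness can be removed by averaging. A walk that leaves a position by a step in \<open>{1..L}\<close> depending
  on its window commutes with shifts, and two walks at distance \<open>D\<close> are expected to merge after
  \<open>O(L + D / L)\<close> jumps.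

  (1) Stopping at the visited position of least random rank among \<open>T\<close>, two starting points at distance
  \<open>D\<close> fail to be identified with probability \<open>O(\<surd>D / T)\<close> if \<open>L = \<surd>D\<close>, and then are still within
  \<open>O(T \<surd>D)\<close>. Each stage thus keeps the product of failure probability and distance bounded up to a
  constant factor, while the distance goes from \<open>1\<close> to about \<open>T\<^sup>2\<close> in \<open>log log T\<close> stages.

  (2) With \<open>L\<close> slightly below \<open>\<surd>n\<close>, walks at distance at most \<open>L\<close> merge within half a turn around the
  cycle, except with superpolynomially small probability. Hence a walk merges with itself after one
  turn, all walks end in the same cycle, and the least window on this cycle is a canonical position.

  Lower bounds: if \<open>y\<close> is independent of \<open>x\<close>, then replacing the bits of \<open>y\<close> read by \<open>h\<close> on \<open>x\<close> by those
  of \<open>x\<close> gives a uniform string \<open>z\<close> with \<open>h z = h x\<close>. For a random shift \<open>r < R\<close> the computation on the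
  shifted \<open>y\<close> notices the replacement with probability at most \<open>d\<^sup>2 / (2 R)\<close>, since a bit read in both
  computations has to differ, and otherwise \<open>h x\<close> predicts \<open>r\<close>. The factor \<open>1 / 2\<close> covers \<open>d\<close> up to \<open>\<surd>n\<close>.
\<close>

section \<open>Lower bound\<close>

lemma finite_bitstrings [simp]: "finite (bitstrings n)"
  and card_bitstrings [simp]: "card (bitstrings n) = 2 ^ n"
  using finite_lists_length_eq[of "UNIV :: bool set" n] card_lists_length_eq[of "UNIV :: bool set" n]
  by (simp_all add: bitstrings_def)

lemma bitstrings_nonempty [simp]: "bitstrings n \<noteq> {}"
  using card_bitstrings[of n] by (metis card.empty power_not_zero zero_neq_numeral)

lemma rotate_bitstrings [simp]: "rotate m x \<in> bitstrings n \<longleftrightarrow> x \<in> bitstrings n"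
  by (simp add: bitstrings_def)

lemma rotate1_bitstrings [simp]: "rotate1 x \<in> bitstrings n \<longleftrightarrow> x \<in> bitstrings n"
  by (simp add: bitstrings_def)

lemma bij_betw_rotate: "bij_betw (rotate m) (bitstrings n) (bitstrings n)"
proof -
  have "inj (rotate m :: bool list \<Rightarrow> bool list)"
  proof (induction m)
    case (Suc m)
    have "inj (rotate1 \<circ> rotate m :: bool list \<Rightarrow> bool list)"
      by (rule inj_compose[OF inj_rotate1 Suc])
    then show ?case by (simp add: rotate_def comp_def)
  qed (simp add: rotate_def)
  then have "inj_on (rotate m) (bitstrings n)" by (rule inj_on_subset) simp
  moreover have "rotate m ` bitstrings n \<subseteq> bitstrings n" by auto
  ultimately show ?thesis
    by (simp add: bij_betw_def endo_inj_surj)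
qed

definition errors :: "nat \<Rightarrow> (bool list \<Rightarrow> nat) \<Rightarrow> bool list set" where
  "errors n h = {x \<in> bitstrings n. h x \<noteq> (h (rotate1 x) + 1) mod n}"

lemma finite_errors [simp]: "finite (errors n h)"
  by (simp add: errors_def)

lemma lphs_return_pmf:
  fixes \<delta> :: real
  shows "lphs n d \<delta> (return_pmf h) \<longleftrightarrow>
     h \<in> bitstrings n \<rightarrow> {..<n} \<and> query_computable n d h \<and> card (errors n h) \<le> \<delta> * 2 ^ n"
proof -
  have *: "bitstrings n \<inter> Pair h -` {(h, x). h x \<noteq> (h (rotate1 x) + 1) mod n} = errors n h"
    by (auto simp: errors_def)
  show ?thesis
    by (simp add: lphs_def pair_return_pmf1 measure_pmf_of_set field_simps * [simplified])
qed

text \<open>The error probability of \<open>H\<close> is the mean over \<open>h\<close> of the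
  fraction of strings in \<open>errors n h\<close>, so a bound that holds on the whole support
  passes to the mixture. Lower bounds need only be shown for deterministic functions.\<close>

lemma lphs_ge:
  fixes c :: real
  assumes H: "lphs n d \<delta> H" and c: "\<And>h. h \<in> set_pmf H \<Longrightarrow> c * 2 ^ n \<le> card (errors n h)"
  shows "c \<le> \<delta>"
proof -
  let ?A = "{(h, x). h x \<noteq> (h (rotate1 x) + 1) mod n}"
  let ?p = "\<lambda>h. measure_pmf.prob (pmf_of_set (bitstrings n)) (Pair h -` ?A)"
  have "measure_pmf.prob (pair_pmf H (pmf_of_set (bitstrings n))) ?A
      = measure_pmf.prob (bind_pmf H (\<lambda>h. map_pmf (Pair h) (pmf_of_set (bitstrings n)))) ?A"
    by (simp add: pair_pmf_def map_pmf_def)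
  also have "\<dots> = measure_pmf.expectation H ?p"
    by (subst measure_pmf_bind) 
       (simp add: measure_pmf.measure_bind[where N = "count_space UNIV"] measure_pmf_in_subprob_algebra)
  finally have eq: "measure_pmf.prob (pair_pmf H (pmf_of_set (bitstrings n))) ?A = measure_pmf.expectation H ?p" .
  have *: "bitstrings n \<inter> Pair h -` ?A = errors n h" for h
    by (auto simp: errors_def)
  have "c \<le> ?p h" if "h \<in> set_pmf H" for h
    using c[OF that] by (simp add: measure_pmf_of_set * [simplified] field_simps)
  then have "c \<le> measure_pmf.expectation H ?p"
    by (intro measure_pmf.integral_ge_const measure_pmf.integrable_const_bound[where B = 1])
       (auto simp: AE_measure_pmf_iff)
  with eq H show ?thesis
    by (simp add: lphs_def)
qed

section \<open>Splicing two inputs along the path of a decision tree\<close>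

primrec path :: "'a dtree \<Rightarrow> bool list \<Rightarrow> nat set" where
  "path (Output a) x = {}"
| "path (Query i l r) x = insert i (if x ! i then path r x else path l x)"

lemma finite_path [simp]: "finite (path t x)"
  by (induction t) auto

lemma card_path: "card (path t x) \<le> query_depth t"
  by (induction t) (auto intro: card_insert_le_m1 le_trans[OF card_insert_le_m1] simp: card_insert_if)

lemma path_subset: "path t x \<subseteq> queried t"
  by (induction t) auto

lemma agree_on_path:
  assumes "\<And>i. i \<in> path t x \<Longrightarrow> x ! i = y ! i"
  shows "path t y = path t x" and "eval_tree t y = eval_tree t x"
  using assms by (induction t) (auto split: if_splits)

definition splice_bits :: "nat set \<Rightarrow> bool list \<Rightarrow> bool list \<Rightarrow> bool list" where
  "splice_bits Q x y = map (\<lambda>i. if i \<in> Q then x ! i else y ! i) [0..<length x]"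

lemma length_splice_bits [simp]: "length (splice_bits Q x y) = length x"
  by (simp add: splice_bits_def)

lemma nth_splice_bits:
  "i < length x \<Longrightarrow> splice_bits Q x y ! i = (if i \<in> Q then x ! i else y ! i)"
  by (simp add: splice_bits_def)

text \<open>Exchanging the bits of \<open>x\<close> and \<open>y\<close> at the positions in
  \<open>path t x\<close> is an involution on pairs: the new first string agrees with
  \<open>x\<close> on that path, so \<open>t\<close> reads the same positions again and a second
  exchange undoes the first. Hence the spliced string is uniform.\<close>

lemma sum_splice_bits:
  fixes f :: "bool list \<Rightarrow> real"
  assumes q: "queried t \<subseteq> {..<n}"
  shows "(\<Sum>x\<in>bitstrings n. \<Sum>y\<in>bitstrings n. f (splice_bits (path t x) x y))
    = 2 ^ n * (\<Sum>z\<in>bitstrings n. f z)"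
proof -
  let ?B = "bitstrings n"
  define \<phi> where "\<phi> = (\<lambda>(x, y). (splice_bits (path t x) x y, splice_bits (path t x) y x))"
  have inv: "\<phi> (\<phi> p) = p" and mem: "\<phi> p \<in> ?B \<times> ?B" if "p \<in> ?B \<times> ?B" for p
  proof -
    obtain x y where p: "p = (x, y)" by force
    have len: "length x = n" "length y = n" using that p by (auto simp: bitstrings_def)
    have "x ! i = splice_bits (path t x) x y ! i" if "i \<in> path t x" for i
      using that path_subset[of t x] q len by (auto simp: nth_splice_bits)
    then have "path t (splice_bits (path t x) x y) = path t x"
      by (rule agree_on_path)
    then show "\<phi> (\<phi> p) = p"
      using len by (auto simp: p \<phi>_def nth_splice_bits split: if_splits intro!: nth_equalityI)
    show "\<phi> p \<in> ?B \<times> ?B"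
      using len by (auto simp: p \<phi>_def bitstrings_def)
  qed
  have "(\<Sum>x\<in>?B. \<Sum>y\<in>?B. f (splice_bits (path t x) x y)) = (\<Sum>p\<in>?B \<times> ?B. f (fst (\<phi> p)))"
    by (simp add: sum.cartesian_product \<phi>_def case_prod_unfold)
  also have "\<dots> = (\<Sum>p\<in>?B \<times> ?B. f (fst p))"
    by (rule sum.reindex_bij_witness[of _ \<phi> \<phi>]) (auto simp: inv mem)
  also have "\<dots> = (\<Sum>x\<in>?B. \<Sum>y\<in>?B. f x)"
    by (simp only: sum.cartesian_product case_prod_unfold)
  finally show ?thesis
    by (simp add: sum_distrib_left)
qed

text \<open>Single shifts telescope: passing from \<open>r\<close> to \<open>Suc r\<close> can fail
  only if \<open>rotate r x\<close> is an error, and rotation is a bijection, so each further shift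
  costs at most \<open>card (errors n h)\<close> strings.\<close>

lemma card_shift_errors:
  assumes "h \<in> bitstrings n \<rightarrow> {..<n}"
  shows "card {x \<in> bitstrings n. h x \<noteq> (h (rotate r x) + r) mod n} \<le> r * card (errors n h)"
proof (induction r)
  case 0
  have "{x \<in> bitstrings n. h x \<noteq> (h (rotate 0 x) + 0) mod n} = {}"
    using assms by (auto simp: Pi_def)
  then show ?case by simp
next
  case (Suc r)
  let ?E = "\<lambda>r. {x \<in> bitstrings n. h x \<noteq> (h (rotate r x) + r) mod n}"
  have "?E (Suc r) \<subseteq> ?E r \<union> {x \<in> bitstrings n. rotate r x \<in> errors n h}"
  proof
    fix x assume x: "x \<in> ?E (Suc r)"
    { assume "h x = (h (rotate r x) + r) mod n" "h (rotate r x) = (h (rotate1 (rotate r x)) + 1) mod n"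
      then have "h x = ((h (rotate1 (rotate r x)) + 1) mod n + r) mod n" by simp
      then have "h x = (h (rotate (Suc r) x) + Suc r) mod n"
        by (simp add: mod_add_left_eq) }
    with x show "x \<in> ?E r \<union> {x \<in> bitstrings n. rotate r x \<in> errors n h}"
      by (auto simp: errors_def)
  qed
  then have "card (?E (Suc r)) \<le> card (?E r) + card {x \<in> bitstrings n. rotate r x \<in> errors n h}"
    by (rule order.trans[OF card_mono card_Un_le, rotated]) simp
  also have "card {x \<in> bitstrings n. rotate r x \<in> errors n h} = card (errors n h)"
  proof (rule bij_betw_same_card)
    have "{x \<in> bitstrings n. rotate r x \<in> errors n h} = bitstrings n \<inter> rotate r -` errors n h" by auto
    moreover have "rotate r ` (bitstrings n \<inter> rotate r -` errors n h) = errors n h"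
      using bij_betw_rotate[of r n] by (force simp: errors_def bij_betw_def)
    ultimately show "bij_betw (rotate r) {x \<in> bitstrings n. rotate r x \<in> errors n h} (errors n h)"
      using bij_betw_rotate[of r n] by (auto simp: bij_betw_def intro: inj_on_subset)
  qed
  finally show ?case using Suc by simp
qed

lemma sum_of_bool_shift_le_1:
  fixes a b n R :: nat
  assumes "R \<le> n"
  shows "(\<Sum>r<R. of_bool (a = (b + r) mod n)) \<le> (1::real)"
proof -
  have "(\<Sum>r<R. of_bool (a = (b + r) mod n)) = real (card ({..<R} \<inter> {r. a = (b + r) mod n}))"
    by simp
  also have "card ({..<R} \<inter> {r. a = (b + r) mod n}) \<le> 1"
  proof -
    have le: "r' \<le> r" if "r < R" "r' < R" "(b + r) mod n = (b + r') mod n" for r r'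
    proof (rule ccontr)
      assume "\<not> r' \<le> r"
      then have "n dvd (b + r') - (b + r)"
        using that(3) by (subst mod_eq_dvd_iff_nat[symmetric]) auto
      with \<open>\<not> r' \<le> r\<close> that(2) assms show False
        by (auto dest: dvd_imp_le)
    qed
    have "r = r'" if "r < R" "r' < R" "(b + r) mod n = (b + r') mod n" for r r'
      using le[OF that] le[OF that(2,1) that(3)[symmetric]] by simp
    then show ?thesis
      by (auto simp: card_le_Suc0_iff_eq)
  qed
  finally show ?thesis by simp
qed

text \<open>A pointwise inequality is summed over all \<open>r < R\<close>, \<open>x\<close> and
  \<open>y\<close>. The three terms on the right bound, in this order, the failures of shift
  \<open>r\<close> on the spliced string (\<open>f1\<close>), the events that \<open>h x\<close>
  predicts \<open>r\<close> (\<open>f2\<close>), and the pairs of different bits read at the same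
  place in both computations (\<open>f3\<close>).\<close>

lemma errors_lower_bound:
  fixes t :: "nat dtree"
  assumes h: "h \<in> bitstrings n \<rightarrow> {..<n}"
    and t: "query_depth t \<le> d" "queried t \<subseteq> {..<n}" "\<And>x. x \<in> bitstrings n \<Longrightarrow> h x = eval_tree t x"
    and R: "R \<le> n"
  shows "real R * 2 ^ n \<le> real R ^ 2 * card (errors n h) + 2 ^ n + real d ^ 2 / 2 * 2 ^ n"
proof -
  let ?B = "bitstrings n"
  let ?z = "\<lambda>x y. splice_bits (path t x) x y"
  define f1 :: "nat \<Rightarrow> bool list \<Rightarrow> real" where
    "f1 = (\<lambda>r z. of_bool (h z \<noteq> (h (rotate r z) + r) mod n))"
  define f2 :: "bool list \<Rightarrow> bool list \<Rightarrow> nat \<Rightarrow> real" where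
    "f2 = (\<lambda>x y r. of_bool (h x = (h y + r) mod n))"
  define f3 :: "bool list \<Rightarrow> bool list \<Rightarrow> nat \<Rightarrow> real" where
    "f3 = (\<lambda>x y r. \<Sum>i\<in>path t x. \<Sum>j\<in>path t y. of_bool (x ! i \<noteq> y ! j) * of_bool (i = (j + r) mod n))"
  \<comment> \<open>If \<open>f3\<close> vanishes, the spliced string and its rotation are hashed to
    \<open>h x\<close> and \<open>h (rotate r y)\<close>. If \<open>f1\<close> vanishes as well, the
    shift identity for the spliced string makes \<open>f2\<close> equal to 1.\<close>
  have pw: "1 \<le> f1 r (?z x y) + (f2 x (rotate r y) r + f3 x (rotate r y) r)"
    if x: "x \<in> ?B" and y: "y \<in> ?B" for x y r
  proof (rule ccontr)
    assume "\<not> ?thesis"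
    moreover have "f1 r (?z x y) \<ge> 0" "f2 x (rotate r y) r \<ge> 0" "f3 x (rotate r y) r \<ge> 0"
      by (auto simp: f1_def f2_def f3_def intro!: sum_nonneg)
    ultimately have *: "f1 r (?z x y) < 1" "f2 x (rotate r y) r < 1" "f3 x (rotate r y) r < 1"
      by linarith+
    have len: "length x = n" "length y = n" using x y by (auto simp: bitstrings_def)
    have 1: "h (?z x y) = (h (rotate r (?z x y)) + r) mod n"
      and 2: "h x \<noteq> (h (rotate r y) + r) mod n"
      using *(1,2) by (auto simp: f1_def f2_def split: if_splits)
    have 3: "x ! i = rotate r y ! j"
      if "i \<in> path t x" "j \<in> path t (rotate r y)" "i = (j + r) mod n" for i j
    proof (rule ccontr)
      assume "x ! i \<noteq> rotate r y ! j"
      then have "1 \<le> of_bool (x ! i \<noteq> rotate r y ! j) * (of_bool (i = (j + r) mod n) :: real)"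
        using that by simp
      also have "\<dots> \<le> (\<Sum>j\<in>path t (rotate r y). of_bool (x ! i \<noteq> rotate r y ! j) * of_bool (i = (j + r) mod n))"
        by (rule member_le_sum) (use that in auto)
      also have "\<dots> \<le> f3 x (rotate r y) r"
        unfolding f3_def by (rule member_le_sum) (use that in \<open>auto intro: sum_nonneg\<close>)
      finally show False using *(3) by simp
    qed
    have zB: "?z x y \<in> ?B" using len by (simp add: bitstrings_def)
    have "h (?z x y) = h x"
      using t(3)[OF zB] t(3)[OF x] agree_on_path(2)[of t x "?z x y"] path_subset[of t x] t(2) len
      by (force simp: nth_splice_bits)
    moreover have "h (rotate r (?z x y)) = h (rotate r y)"
    proof -
      have "rotate r y ! j = rotate r (?z x y) ! j" if j: "j \<in> path t (rotate r y)" for j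
      proof -
        have jn: "j < n" using j path_subset[of t] t(2) by force
        then have "rotate r y ! j = y ! ((r + j) mod n)"
          "rotate r (?z x y) ! j = ?z x y ! ((r + j) mod n)"
          using len by (simp_all add: nth_rotate)
        moreover have "(r + j) mod n < n" using jn by simp
        ultimately show ?thesis
          using 3[OF _ j, of "(r + j) mod n"] len by (auto simp: nth_splice_bits add.commute)
      qed
      then show ?thesis
        using t(3)[of "rotate r y"] t(3)[of "rotate r (?z x y)"] x y zB
          agree_on_path(2)[of t "rotate r y" "rotate r (?z x y)"] by simp
    qed
    ultimately show False using 1 2 by simp
  qed
  have four: "(4::real) ^ n = 2 ^ n * 2 ^ n"
    by (simp flip: power_mult_distrib)
  have "real R * 4 ^ n = (\<Sum>r<R. \<Sum>x\<in>?B. \<Sum>y\<in>?B. 1)"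
    by (simp add: four)
  also have "\<dots> \<le> (\<Sum>r<R. \<Sum>x\<in>?B. \<Sum>y\<in>?B. f1 r (?z x y) + (f2 x (rotate r y) r + f3 x (rotate r y) r))"
    by (intro sum_mono pw) auto
  also have "\<dots> = (\<Sum>r<R. \<Sum>x\<in>?B. \<Sum>y\<in>?B. f1 r (?z x y))
      + (\<Sum>r<R. \<Sum>x\<in>?B. \<Sum>y\<in>?B. f2 x (rotate r y) r + f3 x (rotate r y) r)"
    by (simp only: sum.distrib)
  \<comment> \<open>Renaming the rotated string to \<open>y\<close> removes \<open>r\<close> from
    the arguments of the hash function. For fixed \<open>x\<close> and \<open>y\<close>, the sum
    over \<open>r\<close> then only counts coincidences of residues, at most one for each
    pair.\<close>
  also have "(\<Sum>r<R. \<Sum>x\<in>?B. \<Sum>y\<in>?B. f2 x (rotate r y) r + f3 x (rotate r y) r)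
      = (\<Sum>r<R. \<Sum>x\<in>?B. \<Sum>y\<in>?B. f2 x y r + f3 x y r)"
    by (intro sum.cong refl sum.reindex_bij_betw[OF bij_betw_rotate])
  also have "\<dots> = (\<Sum>x\<in>?B. \<Sum>y\<in>?B. \<Sum>r<R. f2 x y r + f3 x y r)"
    by (subst sum.swap, rule sum.cong[OF refl], rule sum.swap)
  also have "\<dots> = (\<Sum>x\<in>?B. \<Sum>y\<in>?B. \<Sum>r<R. f2 x y r) + (\<Sum>x\<in>?B. \<Sum>y\<in>?B. \<Sum>r<R. f3 x y r)"
    by (simp only: sum.distrib)
  also have "(\<Sum>x\<in>?B. \<Sum>y\<in>?B. \<Sum>r<R. f2 x y r) \<le> (\<Sum>x\<in>?B. \<Sum>y\<in>?B. 1)"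
    unfolding f2_def by (intro sum_mono sum_of_bool_shift_le_1 R)
  also have "(\<Sum>x\<in>?B. \<Sum>y\<in>?B. \<Sum>r<R. f3 x y r) \<le> real d ^ 2 / 2 * 4 ^ n"
  proof -
    let ?a = "\<lambda>v x. real (card {i \<in> path t x. x ! i = v})"
    have f3: "(\<Sum>r<R. f3 x y r) \<le> ?a True x * ?a False y + ?a False x * ?a True y" for x y
    proof -
      have "(\<Sum>r<R. f3 x y r) = (\<Sum>i\<in>path t x. \<Sum>j\<in>path t y. \<Sum>r<R.
          of_bool (x ! i \<noteq> y ! j) * of_bool (i = (j + r) mod n))"
        unfolding f3_def by (subst sum.swap, rule sum.cong[OF refl], rule sum.swap)
      also have "\<dots> \<le> (\<Sum>i\<in>path t x. \<Sum>j\<in>path t y. of_bool (x ! i \<noteq> y ! j) * 1)"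
        by (intro sum_mono) (simp only: flip: sum_distrib_left, intro mult_left_mono sum_of_bool_shift_le_1 R, simp)
      also have "\<dots> = (\<Sum>i\<in>path t x. \<Sum>j\<in>path t y.
          of_bool (x ! i) * of_bool (\<not> y ! j) + of_bool (\<not> x ! i) * of_bool (y ! j))"
        by (intro sum.cong refl) auto
      also have "\<dots> = (\<Sum>i\<in>path t x. of_bool (x ! i)) * (\<Sum>j\<in>path t y. of_bool (\<not> y ! j))
          + (\<Sum>i\<in>path t x. of_bool (\<not> x ! i)) * (\<Sum>j\<in>path t y. of_bool (y ! j))"
        by (simp only: sum.distrib sum_product)
      finally show ?thesis by (simp add: Int_def)
    qed
    \<comment> \<open>\<open>A\<close> and \<open>B\<close> count the ones and the zeros read, over
      all inputs. Only a one against a zero contributes to \<open>f3\<close>, so the total is at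
      most \<open>2 * A * B\<close>, and the inequality of the means gives the factor 1/2.\<close>
    define A B where "A = (\<Sum>x\<in>?B. ?a True x)" and "B = (\<Sum>x\<in>?B. ?a False x)"
    have "A + B = (\<Sum>x\<in>?B. real (card (path t x)))"
    proof -
      have "?a True x + ?a False x = real (card (path t x))" for x
      proof -
        have "path t x = {i \<in> path t x. x ! i = True} \<union> {i \<in> path t x. x ! i = False}" by auto
        then have "card (path t x) = card {i \<in> path t x. x ! i = True} + card {i \<in> path t x. x ! i = False}"
          by (subst card_Un_disjoint[symmetric]) auto
        then show ?thesis by linarith
      qed
      then show ?thesis by (simp only: A_def B_def flip: sum.distrib)
    qed
    also have "\<dots> \<le> (\<Sum>x\<in>?B. real d)"
      by (intro sum_mono) (simp only: of_nat_le_iff, rule order.trans[OF card_path t(1)])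
    finally have AB: "A + B \<le> real d * 2 ^ n" by (simp add: mult.commute)
    have "(\<Sum>x\<in>?B. \<Sum>y\<in>?B. \<Sum>r<R. f3 x y r) \<le> (\<Sum>x\<in>?B. \<Sum>y\<in>?B. ?a True x * ?a False y + ?a False x * ?a True y)"
      by (intro sum_mono f3)
    also have "\<dots> = A * B + B * A"
      by (simp only: A_def B_def sum.distrib sum_product)
    also have "\<dots> \<le> (A + B)\<^sup>2 / 2"
      using zero_le_power2[of "A - B"] by (simp add: power2_eq_square algebra_simps)
    also have "\<dots> \<le> (real d * 2 ^ n)\<^sup>2 / 2"
      using AB by (intro divide_right_mono power_mono) (auto simp: A_def B_def intro!: add_nonneg_nonneg sum_nonneg)
    finally show ?thesis
      by (simp add: power2_eq_square four mult_ac)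
  qed
  also have "(\<Sum>r<R. \<Sum>x\<in>?B. \<Sum>y\<in>?B. f1 r (?z x y)) = (\<Sum>r<R. 2 ^ n * (\<Sum>z\<in>?B. f1 r z))"
    by (intro sum.cong refl sum_splice_bits t)
  also have "\<dots> \<le> (\<Sum>r<R. 2 ^ n * (real R * card (errors n h)))"
  proof (intro sum_mono mult_left_mono)
    fix r assume r: "r \<in> {..<R}"
    have "(\<Sum>z\<in>?B. f1 r z) = real (card {x \<in> ?B. h x \<noteq> (h (rotate r x) + r) mod n})"
      by (simp add: f1_def Int_def)
    also have "\<dots> \<le> real (r * card (errors n h))"
      using card_shift_errors[OF h] of_nat_mono by blast
    also have "\<dots> \<le> real R * card (errors n h)"
      using r by (auto intro: mult_right_mono)
    finally show "(\<Sum>z\<in>?B. f1 r z) \<le> real R * card (errors n h)" .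
  qed simp
  finally have "real R * 4 ^ n \<le> (\<Sum>r<R. 2 ^ n * (real R * card (errors n h))) + ((\<Sum>x\<in>?B. \<Sum>y\<in>?B. 1) + real d ^ 2 / 2 * 4 ^ n)"
    by simp
  then have "2 ^ n * (real R * 2 ^ n) \<le> 2 ^ n * (real R ^ 2 * card (errors n h) + 2 ^ n + real d ^ 2 / 2 * 2 ^ n)"
    by (simp add: power2_eq_square four algebra_simps)
  then show ?thesis by simp
qed

text \<open>With \<open>R = max 3 (d\<^sup>2)\<close>, the prediction term takes at most a third and
  the collision term at most half of \<open>R * 2 ^ n\<close>. A sixth is left for the errors, and
  \<open>R \<le> 3 * d\<^sup>2\<close> turns 6 into 18.\<close>

lemma lphs_error_ge:
  assumes n: "n \<ge> 2" and d: "d > 0" "real d \<le> sqrt (real n)" and H: "lphs n d \<delta> H"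
  shows "1 / real d ^ 2 \<le> 18 * \<delta>"
proof -
  have dn: "d\<^sup>2 \<le> n"
    using power_mono[OF d(2), of 2] by (simp flip: of_nat_power)
  have "1 / (18 * real d ^ 2) \<le> \<delta>"
  proof (rule lphs_ge[OF H])
    fix h assume "h \<in> set_pmf H"
    with H have h: "h \<in> bitstrings n \<rightarrow> {..<n}" and q: "query_computable n d h"
      by (auto simp: lphs_def)
    show "1 / (18 * real d ^ 2) * 2 ^ n \<le> card (errors n h)"
    proof (cases "n = 2")
      \<comment> \<open>Here \<open>R \<ge> 3\<close> would exceed \<open>n\<close>. A constant
        string is fixed by the rotation and is therefore always an error.\<close>
      case True
      with dn have "d * d \<le> 2" by (simp add: power2_eq_square)
      with d(1) have "d = 1"
        by (cases d rule: nat.exhaust; cases "d - 1") auto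
      have "h (replicate n False) < n"
        using h by (auto simp: Pi_def bitstrings_def)
      then have "replicate n False \<in> errors n h"
        using n by (cases "Suc (h (replicate n False)) = n") (auto simp: errors_def bitstrings_def)
      then have "card (errors n h) \<ge> 1"
        by (metis card_0_eq empty_iff finite_errors less_one not_le)
      then show ?thesis using True \<open>d = 1\<close> by simp
    next
      case False
      obtain t where t: "query_depth t \<le> d" "queried t \<subseteq> {..<n}" "\<And>x. x \<in> bitstrings n \<Longrightarrow> h x = eval_tree t x"
        using q by (auto simp: query_computable_def)
      define R where "R = max 3 (d\<^sup>2)"
      have R: "R \<le> n" "R \<ge> 3" "R \<ge> d\<^sup>2" "R \<le> 3 * d\<^sup>2"
        using n False dn d(1) by (auto simp: R_def)
      have R': "3 \<le> real R" "real d ^ 2 \<le> real R" "real R \<le> 3 * real d ^ 2"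
        using R(2,3) of_nat_mono[OF R(4), where 'a = real] by (simp_all flip: of_nat_power)
      let ?N = "(2::real) ^ n"
      have "real R * ?N \<le> real R ^ 2 * card (errors n h) + ?N + real d ^ 2 / 2 * ?N"
        using errors_lower_bound[OF h t R(1)] by simp
      moreover have "real d ^ 2 / 2 * ?N \<le> real R / 2 * ?N"
        using R' by (intro mult_right_mono) auto
      moreover have "?N \<le> real R / 3 * ?N"
        using R' by simp
      ultimately have "real R * ?N \<le> real R ^ 2 * card (errors n h) + real R / 3 * ?N + real R / 2 * ?N"
        by linarith
      then have "real R * (?N / 6) \<le> real R * (real R * card (errors n h))"
        by (simp add: power2_eq_square mult.assoc)
      then have "?N / 6 \<le> real R * card (errors n h)"
        using R' by (simp add: mult_le_cancel_left)
      also have "\<dots> \<le> 3 * real d ^ 2 * card (errors n h)"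
        using R' by (intro mult_right_mono) auto
      finally show ?thesis using d(1) by (simp add: field_simps)
    qed
  qed
  then show ?thesis using d(1) by (simp add: field_simps)
qed

lemma query_computable_mono: "query_computable n d h \<Longrightarrow> d \<le> d' \<Longrightarrow> query_computable n d' h"
  by (auto simp: query_computable_def intro: order.trans)

lemma lphs_mono: "lphs n d \<delta> H \<Longrightarrow> d \<le> d' \<Longrightarrow> lphs n d' \<delta> H"
  by (auto simp: lphs_def intro: query_computable_mono)

text \<open>If \<open>d n\<close> were below the square root of \<open>n\<close>, the error would be
  at least \<open>1 / (18 * n)\<close>, whereas \<open>w n \<ge> 2\<close> forces it to be at most
  \<open>1 / n\<^sup>2\<close>. The two are incompatible from \<open>n = 19\<close> on. Raising
  \<open>d n\<close> to at least 1 makes the lower bound applicable.\<close>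

lemma superpoly_small_query_bound:
  assumes "superpoly_small \<delta>" and H: "\<forall>n>0. lphs n (d n) (\<delta> n) (H n)"
  shows "\<forall>\<^sub>F n in sequentially. sqrt (real n) \<le> real (d n)"
proof -
  obtain w where w: "filterlim w at_top sequentially" "\<forall>\<^sub>F n in sequentially. \<delta> n \<le> real n powr (- w n)"
    using assms(1) by (auto simp: superpoly_small_def)
  have "\<forall>\<^sub>F n in sequentially. w n \<ge> 2"
    using w(1) by (auto simp: filterlim_at_top)
  then show ?thesis
    using w(2) eventually_ge_at_top[of 19]
  proof eventually_elim
    case (elim n)
    show ?case
    proof (rule ccontr)
      assume "\<not> ?case"
      then have less: "real (d n) \<le> sqrt (real n)" by simp
      define d' where "d' = max 1 (d n)"
      have d': "d' > 0" "real d' \<le> sqrt (real n)"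
        using less elim(3) by (simp_all add: d'_def of_nat_max)
      have "lphs n d' (\<delta> n) (H n)"
        using H elim(3) lphs_mono[of n "d n" "\<delta> n" "H n" d'] by (simp add: d'_def)
      then have "1 / real d' ^ 2 \<le> 18 * \<delta> n"
        using lphs_error_ge[of n d' "\<delta> n" "H n"] elim(3) d' by simp
      moreover have "real d' ^ 2 \<le> real n"
        using power_mono[OF d'(2), of 2] by simp
      then have "1 / real n \<le> 1 / real d' ^ 2"
        using d' elim(3) by (intro divide_left_mono) auto
      moreover have "\<delta> n \<le> real n powr (-2)"
        by (rule order.trans[OF elim(2) powr_mono]) (use elim(1,3) in auto)
      then have "\<delta> n \<le> 1 / (real n * real n)"
        using elim(3) by (simp add: powr_minus powr_numeral power2_eq_square field_simps)
      ultimately have "1 / real n \<le> 18 / (real n * real n)" by linarith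
      then show False using elim(3) by (simp add: field_simps)
    qed
  qed
qed

section \<open>Hashing along walks\<close>

primrec bind_dtree :: "'a dtree \<Rightarrow> ('a \<Rightarrow> 'b dtree) \<Rightarrow> 'b dtree" where
  "bind_dtree (Output a) f = f a"
| "bind_dtree (Query i l r) f = Query i (bind_dtree l f) (bind_dtree r f)"

lemma eval_bind_dtree [simp]: "eval_tree (bind_dtree t f) x = eval_tree (f (eval_tree t x)) x"
  by (induction t) auto

lemma query_depth_bind_dtree:
  "(\<And>a. query_depth (f a) \<le> d) \<Longrightarrow> query_depth (bind_dtree t f) \<le> query_depth t + d"
  by (induction t) (auto intro: le_trans simp: max_def le_add2)

lemma queried_bind_dtree:
  "queried t \<subseteq> A \<Longrightarrow> (\<And>a. queried (f a) \<subseteq> A) \<Longrightarrow> queried (bind_dtree t f) \<subseteq> A"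
  by (induction t) auto

lemma query_computable_const: "query_computable n 0 (\<lambda>x. a)"
  unfolding query_computable_def by (rule exI[of _ "Output a"]) auto

text \<open>Adaptivity enters here: the second computation may depend on the outcome of the first,
  and the depths add up because the tree for \<open>g a\<close> is grafted onto the leaves labelled
  \<open>a\<close>.\<close>

lemma query_computable_bind:
  assumes f: "query_computable n d1 f" and g: "\<And>a. query_computable n d2 (g a)"
  shows "query_computable n (d1 + d2) (\<lambda>x. g (f x) x)"
proof -
  obtain t where t: "query_depth t \<le> d1" "queried t \<subseteq> {..<n}" "\<forall>x\<in>bitstrings n. f x = eval_tree t x"
    using f by (auto simp: query_computable_def)
  obtain u where u: "\<And>a. query_depth (u a) \<le> d2" "\<And>a. queried (u a) \<subseteq> {..<n}"
      "\<And>a. \<forall>x\<in>bitstrings n. g a x = eval_tree (u a) x"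
    using g unfolding query_computable_def by metis
  have "query_depth (bind_dtree t u) \<le> d1 + d2"
    using query_depth_bind_dtree[of u d2 t, OF u(1)] t(1) by simp
  moreover have "queried (bind_dtree t u) \<subseteq> {..<n}"
    using t u by (intro queried_bind_dtree)
  moreover have "\<forall>x\<in>bitstrings n. g (f x) x = eval_tree (bind_dtree t u) x"
    using t u by simp
  ultimately show ?thesis
    unfolding query_computable_def by blast
qed

lemma query_computable_map:
  "query_computable n d f \<Longrightarrow> query_computable n d (\<lambda>x. g (f x))"
  using query_computable_bind[of n d f 0 "\<lambda>a x. g a"] by (simp add: query_computable_const)

lemma query_computable_nth: "i < n \<Longrightarrow> query_computable n 1 (\<lambda>x. x ! i)"
  unfolding query_computable_def
  by (rule exI[of _ "Query i (Output False) (Output True)"]) auto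

section \<open>Windows, walks and stages\<close>

definition window :: "nat \<Rightarrow> nat \<Rightarrow> bool list \<Rightarrow> nat \<Rightarrow> bool list" where
  "window n k x i = map (\<lambda>j. x ! ((i + j) mod n)) [0..<k]"

lemma length_window [simp]: "length (window n k x i) = k"
  by (simp add: window_def)

lemma window_in_bitstrings [simp]: "window n k x i \<in> bitstrings k"
  by (simp add: bitstrings_def)

lemma window_mod [simp]: "window n k x (i mod n) = window n k x i"
  by (simp add: window_def mod_add_left_eq)

lemma window_rotate:
  assumes "x \<in> bitstrings n" "n > 0"
  shows "window n k (rotate r x) i = window n k x (i + r)"
  using assms by (auto simp: window_def bitstrings_def nth_rotate mod_add_right_eq add_ac)

lemma query_computable_window:
  assumes "n > 0"
  shows "query_computable n k (\<lambda>x. window n k x i)"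
proof (induction k)
  case 0
  show ?case by (simp add: window_def query_computable_const)
next
  case (Suc k)
  have "query_computable n 1 (\<lambda>x. a @ [x ! ((i + k) mod n)])" for a
    by (rule query_computable_map) (simp add: assms query_computable_nth[of "(i + k) mod n" n, simplified])
  from query_computable_bind[OF Suc this] show ?case
    by (simp add: window_def)
qed

text \<open>Positions are not reduced modulo \<open>n\<close>; only \<^const>\<open>window\<close> wraps around.\<close>

primrec trace :: "nat \<Rightarrow> nat \<Rightarrow> (bool list \<Rightarrow> nat) \<Rightarrow> bool list \<Rightarrow> nat \<Rightarrow> nat \<Rightarrow> bool list list" where
  "trace n k s x 0 a = []"
| "trace n k s x (Suc m) a = window n k x a # trace n k s x m (a + s (window n k x a))"

abbreviation walk :: "nat \<Rightarrow> nat \<Rightarrow> (bool list \<Rightarrow> nat) \<Rightarrow> bool list \<Rightarrow> nat \<Rightarrow> nat \<Rightarrow> nat" where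
  "walk n k s x m a \<equiv> ((\<lambda>i. i + s (window n k x i)) ^^ m) a"

lemma length_trace [simp]: "length (trace n k s x m a) = m"
  by (induction m arbitrary: a) auto

lemma nth_trace: "j < m \<Longrightarrow> trace n k s x m a ! j = window n k x (walk n k s x j a)"
proof (induction m arbitrary: a j)
  case (Suc m)
  then show ?case by (cases j) (auto simp: funpow_Suc_right simp del: funpow.simps)
qed simp

text \<open>The position of a walk can be recovered from the windows it has seen, so whatever is
  computed from the trace costs no queries beyond those of the trace.\<close>

lemma sum_take_trace: "j \<le> m \<Longrightarrow> a + sum_list (map s (take j (trace n k s x m a))) = walk n k s x j a"
proof (induction m arbitrary: a j)
  case (Suc m)
  then show ?case
    by (cases j) (auto simp: funpow_Suc_right simp flip: add.assoc simp del: funpow.simps)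
qed simp

lemma query_computable_trace:
  assumes "n > 0"
  shows "query_computable n (m * k) (\<lambda>x. trace n k s x m a)"
proof (induction m arbitrary: a)
  case 0
  show ?case by (simp add: query_computable_const)
next
  case (Suc m)
  have "query_computable n (m * k) (\<lambda>x. w # trace n k s x m (a + s w))" for w
    by (rule query_computable_map[OF Suc])
  from query_computable_bind[OF query_computable_window[OF assms] this] show ?case
    by simp
qed

lemma trace_rotate1:
  assumes "x \<in> bitstrings n" "n > 0"
  shows "trace n k s (rotate1 x) m a = trace n k s x m (Suc a)"
  using window_rotate[OF assms, of k 1]
  by (induction m arbitrary: a) (auto simp: rotate_def)

text \<open>Choosing the minimum over times rather than positions makes ties harmless: the choice
  depends on the trace only, so it commutes with shifts.\<close>

definition best_time :: "(bool list \<Rightarrow> nat) \<Rightarrow> nat \<Rightarrow> nat \<Rightarrow> bool list list \<Rightarrow> nat" where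
  "best_time \<rho> lo hi tr = arg_min_on (\<lambda>j. \<rho> (tr ! j)) {lo..<hi}"

text \<open>The first construction uses \<open>lo = 0\<close> and a random ranking. The second takes
  \<open>lo\<close> large enough to skip the part of the walk before it becomes periodic.\<close>

definition stage :: "nat \<Rightarrow> nat \<Rightarrow> (bool list \<Rightarrow> nat) \<Rightarrow> (bool list \<Rightarrow> nat) \<Rightarrow> nat \<Rightarrow> nat \<Rightarrow> bool list \<Rightarrow> nat \<Rightarrow> nat" where
  "stage n k s \<rho> lo hi x a =
     (let tr = trace n k s x hi a in a + sum_list (map s (take (best_time \<rho> lo hi tr) tr)))"

lemma query_computable_stage:
  "n > 0 \<Longrightarrow> query_computable n (hi * k) (\<lambda>x. stage n k s \<rho> lo hi x a)"
  unfolding stage_def Let_def by (rule query_computable_map[OF query_computable_trace])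

text \<open>Both sides see the same trace, hence choose the same time and make the same total
  advance; only the starting points differ, by one.\<close>

lemma stage_rotate1:
  assumes "x \<in> bitstrings n" "n > 0"
  shows "Suc (stage n k s \<rho> lo hi (rotate1 x) a) = stage n k s \<rho> lo hi x (Suc a)"
  by (simp add: stage_def trace_rotate1[OF assms] Let_def)

lemma stage_minimal:
  assumes "lo < hi"
  obtains j where "j \<in> {lo..<hi}" "stage n k s \<rho> lo hi x a = walk n k s x j a"
    and "\<And>i. i \<in> {lo..<hi} \<Longrightarrow>
      \<rho> (window n k x (walk n k s x j a)) \<le> \<rho> (window n k x (walk n k s x i a))"
proof -
  let ?tr = "trace n k s x hi a"
  define j where "j = best_time \<rho> lo hi ?tr"
  have j: "j \<in> {lo..<hi}"
    unfolding j_def best_time_def by (rule arg_min_if_finite(1)) (use assms in auto)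
  have "\<rho> (?tr ! j) \<le> \<rho> (?tr ! i)" if "i \<in> {lo..<hi}" for i
    unfolding j_def best_time_def by (rule arg_min_least) (use that in auto)
  with j have "\<rho> (window n k x (walk n k s x j a)) \<le> \<rho> (window n k x (walk n k s x i a))"
    if "i \<in> {lo..<hi}" for i
    using that by (force simp: nth_trace)
  moreover have "stage n k s \<rho> lo hi x a = walk n k s x j a"
    using j sum_take_trace[of j hi a s n k x] by (simp add: stage_def j_def)
  ultimately show thesis using that j by blast
qed

section \<open>Strings without repeated windows\<close>

definition distinct_windows :: "nat \<Rightarrow> nat \<Rightarrow> bool list set" where
  "distinct_windows n k = {x \<in> bitstrings n. inj_on (window n k x) {..<n}}"

lemma window_eq_iff:
  assumes "x \<in> distinct_windows n k" "n > 0"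
  shows "window n k x i = window n k x j \<longleftrightarrow> i mod n = j mod n"
proof
  assume "window n k x i = window n k x j"
  then have eq: "window n k x (i mod n) = window n k x (j mod n)" by simp
  have "inj_on (window n k x) {..<n}"
    using assms by (simp add: distinct_windows_def)
  from inj_onD[OF this eq] show "i mod n = j mod n"
    using assms by simp
next
  assume "i mod n = j mod n"
  then show "window n k x i = window n k x j"
    by (metis window_mod)
qed

text \<open>Any \<open>n\<close> consecutive positions are distinct modulo \<open>n\<close>. The
  start \<open>c\<close> is arbitrary because walks run over unreduced positions.\<close>

lemma inj_on_window:
  assumes "x \<in> distinct_windows n k"
  shows "inj_on (window n k x) {c..<c + n}"
proof (rule linorder_inj_onI')
  fix i j assume ij: "i \<in> {c..<c + n}" "j \<in> {c..<c + n}" "i < j"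
  then have "n > 0" by auto
  have "j mod n \<noteq> i mod n"
  proof
    assume "j mod n = i mod n"
    then have "n dvd j - i"
      using ij by (subst mod_eq_dvd_iff_nat[symmetric]) auto
    with ij show False by (auto dest: dvd_imp_le)
  qed
  with \<open>n > 0\<close> show "window n k x i \<noteq> window n k x j"
    by (simp add: window_eq_iff[OF assms])
qed

text \<open>Each of the \<open>k\<close> bits from position \<open>g\<close> on repeats the bit
  \<open>g\<close> places before it, so deleting this block loses no information. Restoring the bits
  from left to right also handles windows that overlap. The bound \<open>g + k \<le> n\<close>
  excludes wrapping around.\<close>

lemma card_equal_windows_0:
  assumes "g > 0" "g + k \<le> n"
  shows "card {x \<in> bitstrings n. window n k x 0 = window n k x g} \<le> 2 ^ (n - k)"
proof -
  let ?E = "{x \<in> bitstrings n. window n k x 0 = window n k x g}"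
  let ?f = "\<lambda>x. take g x @ drop (g + k) x"
  have eq: "x ! (g + m) = x ! m" if "x \<in> ?E" "m < k" for x m
    using that assms by (auto simp: window_def)
  have "inj_on ?f ?E"
  proof (rule inj_onI)
    fix x y assume x: "x \<in> ?E" and y: "y \<in> ?E" and f: "?f x = ?f y"
    have len: "length x = n" "length y = n"
      using x y by (auto simp: bitstrings_def)
    then have t: "take g x = take g y" and d: "drop (g + k) x = drop (g + k) y"
      using f by auto
    show "x = y"
    proof (rule nth_equalityI)
      fix m assume "m < length x"
      then show "x ! m = y ! m"
      proof (induction m rule: less_induct)
        case (less m)
        consider "m < g" | "g \<le> m" "m < g + k" | "g + k \<le> m" by linarith
        then show ?case
        proof cases
          case 1
          then show ?thesis using t by (metis nth_take)
        next
          case 2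
          then show ?thesis
            using less eq[OF x, of "m - g"] eq[OF y, of "m - g"] assms by auto
        next
          case 3
          have "drop (g + k) x ! (m - (g + k)) = drop (g + k) y ! (m - (g + k))"
            by (simp only: d)
          with 3 less.prems len show ?thesis by simp
        qed
      qed
    qed (simp add: len)
  qed
  moreover have "?f ` ?E \<subseteq> bitstrings (n - k)"
    using assms by (auto simp: bitstrings_def)
  ultimately have "card ?E \<le> card (bitstrings (n - k))"
    by (intro card_inj_on_le) auto
  then show ?thesis by simp
qed

text \<open>A union bound over the position \<open>c\<close> of one of the two equal windows and the
  distance \<open>g\<close> to the other. Measured the shorter way around the cycle,
  \<open>g\<close> is at most \<open>n div 2\<close>, so that \<open>2 * k \<le> n\<close> gives
  \<open>g + k \<le> n\<close>.\<close>

lemma card_not_distinct_windows: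
  assumes "2 * k \<le> n" "n > 0"
  shows "card (bitstrings n - distinct_windows n k) \<le> n * n * 2 ^ (n - k)"
proof -
  let ?E = "\<lambda>g. {x \<in> bitstrings n. window n k x 0 = window n k x g}"
  have "bitstrings n - distinct_windows n k
      \<subseteq> (\<Union>c\<in>{..<n}. \<Union>g\<in>{1..n div 2}. {x \<in> bitstrings n. rotate c x \<in> ?E g})"
  proof
    fix x assume x: "x \<in> bitstrings n - distinct_windows n k"
    then obtain i j where ij: "i < n" "j < n" "i < j" "window n k x i = window n k x j"
      by (auto simp: distinct_windows_def inj_on_def) (metis linorder_neqE_nat)
    have rot: "rotate c x \<in> ?E g" if "window n k x c = window n k x (g + c)" for c g
      using that x assms by (simp add: window_rotate)
    show "x \<in> (\<Union>c\<in>{..<n}. \<Union>g\<in>{1..n div 2}. {x \<in> bitstrings n. rotate c x \<in> ?E g})"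
    proof (cases "j - i \<le> n div 2")
      case True
      then show ?thesis
        using ij x by (intro UN_I[of i] UN_I[of "j - i"] CollectI conjI rot) auto
    next
      case False
      \<comment> \<open>The shorter way leads from \<open>j\<close> across the end of the string to
        \<open>i\<close>.\<close>
      have "window n k x (n - (j - i) + j) = window n k x (i + n)"
        using ij by (intro arg_cong[where f = "window n k x"]) auto
      also have "\<dots> = window n k x i"
        using window_mod[of n k x "i + n"] window_mod[of n k x i] by simp
      finally show ?thesis
        using ij x False by (intro UN_I[of j] UN_I[of "n - (j - i)"] CollectI conjI rot) auto
    qed
  qed
  then have "card (bitstrings n - distinct_windows n k)
      \<le> card (\<Union>c\<in>{..<n}. \<Union>g\<in>{1..n div 2}. {x \<in> bitstrings n. rotate c x \<in> ?E g})"
    by (intro card_mono) auto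
  also have "\<dots> \<le> (\<Sum>c<n. card (\<Union>g\<in>{1..n div 2}. {x \<in> bitstrings n. rotate c x \<in> ?E g}))"
    by (rule card_UN_le) simp
  also have "\<dots> \<le> (\<Sum>c<n. \<Sum>g\<in>{1..n div 2}. card {x \<in> bitstrings n. rotate c x \<in> ?E g})"
    by (intro sum_mono card_UN_le) simp
  also have "\<dots> \<le> (\<Sum>c<n. \<Sum>g\<in>{1..n div 2}. 2 ^ (n - k))"
  proof (intro sum_mono)
    fix c g assume g: "g \<in> {1..n div 2}"
    have "card {x \<in> bitstrings n. rotate c x \<in> ?E g} \<le> card (?E g)"
    proof (rule card_inj_on_le[where f = "rotate c"])
      show "inj_on (rotate c) {x \<in> bitstrings n. rotate c x \<in> ?E g}"
        using bij_betw_rotate[of c n] by (auto simp: bij_betw_def intro: inj_on_subset)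
    qed auto
    also have "\<dots> \<le> 2 ^ (n - k)"
      using g assms by (intro card_equal_windows_0) auto
    finally show "card {x \<in> bitstrings n. rotate c x \<in> ?E g} \<le> 2 ^ (n - k)" .
  qed
  also have "\<dots> = n * (n div 2) * 2 ^ (n - k)" by simp
  also have "\<dots> \<le> n * n * 2 ^ (n - k)"
    by (intro mult_right_mono mult_left_mono) auto
  finally show ?thesis .
qed

section \<open>Coupling of random walks\<close>

text \<open>The windows are abstracted to a sequence \<open>w\<close>; the coupling argument uses
  only that \<open>w\<close> is injective on the range of positions concerned.\<close>

primrec visited :: "('w \<Rightarrow> nat) \<Rightarrow> (nat \<Rightarrow> 'w) \<Rightarrow> nat \<Rightarrow> nat \<Rightarrow> nat set" where
  "visited s w 0 a = {}"
| "visited s w (Suc m) a = insert a (visited s w m (a + s (w a)))"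

lemma finite_visited [simp]: "finite (visited s w m a)"
  by (induction m arbitrary: a) auto

lemma visited_eq: "visited s w m a = (\<lambda>j. ((\<lambda>i. i + s (w i)) ^^ j) a) ` {..<m}"
proof (induction m arbitrary: a)
  case (Suc m)
  have "{..<Suc m} = insert 0 (Suc ` {..<m})"
    by (rule lessThan_Suc_eq_insert_0)
  then show ?case
    by (simp add: Suc image_image funpow_Suc_right del: funpow.simps)
qed simp

lemma card_visited_le: "card (visited s w m a) \<le> m"
  by (simp add: visited_eq card_image_le[of "{..<m}", simplified])

lemma visited_cong:
  "(\<And>i. i \<in> visited s w m a \<Longrightarrow> s' (w i) = s (w i)) \<Longrightarrow> visited s' w m a = visited s w m a"
  by (induction m arbitrary: a) auto

lemma visited_subset:
  assumes "\<And>i. s (w i) \<le> L" "a + m * L \<le> N" "L > 0"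
  shows "visited s w m a \<subseteq> {a..<N}"
  using assms(2)
proof (induction m arbitrary: a)
  case (Suc m)
  have aL: "a + L + m * L \<le> N"
    using Suc.prems by simp
  have "visited s w m (a + s (w a)) \<subseteq> {a + s (w a)..<N}"
    using aL assms(1)[of a] by (intro Suc.IH) linarith
  also have "\<dots> \<subseteq> {a..<N}" by (simp add: atLeastLessThan_subset_iff)
  finally have "visited s w m (a + s (w a)) \<subseteq> {a..<N}" .
  moreover have "a < N"
    using aL assms(3) by linarith
  ultimately show ?case by simp
qed simp

lemma visited_ge: "i \<in> visited s w m a \<Longrightarrow> a \<le> i"
proof (induction m arbitrary: a)
  case (Suc m)
  from Suc.prems Suc.IH[of "a + s (w a)"] show ?case
    by (cases "i = a") simp_all
qed simp

lemma card_visited: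
  assumes "\<And>i. s (w i) > 0"
  shows "card (visited s w m a) = m"
proof (induction m arbitrary: a)
  case (Suc m)
  have "a \<notin> visited s w m (a + s (w a))"
    using visited_ge[of a s w m "a + s (w a)"] assms[of a] by linarith
  with Suc show ?case by simp
qed simp

lemma card_visited_diff: "card (visited s w m a - visited s w m' a) \<le> m - m'"
proof (induction m arbitrary: m' a)
  case (Suc m)
  show ?case
  proof (cases m')
    case 0
    then show ?thesis using card_visited_le[of s w "Suc m" a] by simp
  next
    case (Suc m1)
    have "card (visited s w (Suc m) a - visited s w m' a)
      \<le> card (visited s w m (a + s (w a)) - visited s w m1 (a + s (w a)))"
      unfolding Suc by (intro card_mono) auto
    also have "\<dots> \<le> m - m1" by (rule Suc.IH)
    finally show ?thesis using Suc by simp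
  qed
qed simp

text \<open>Exchanging \<open>v\<close> with the value of \<open>s\<close> at \<open>c\<close> is an
  involution on the pairs \<open>(v, s)\<close>. Thus the value at a single point can be drawn
  afresh without changing an average over all functions.\<close>

lemma sum_PiE_resample:
  fixes G :: "('w \<Rightarrow> 'v) \<Rightarrow> real"
  assumes "c \<in> W"
  shows "(\<Sum>v\<in>S. \<Sum>s\<in>W \<rightarrow>\<^sub>E S. G (s(c := v))) = card S * (\<Sum>s\<in>W \<rightarrow>\<^sub>E S. G s)"
proof -
  have "(\<Sum>v\<in>S. \<Sum>s\<in>W \<rightarrow>\<^sub>E S. G (s(c := v))) = (\<Sum>(v, s)\<in>S \<times> (W \<rightarrow>\<^sub>E S). G (s(c := v)))"
    by (rule sum.cartesian_product)
  also have "\<dots> = (\<Sum>(v, s)\<in>S \<times> (W \<rightarrow>\<^sub>E S). G s)"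
    by (rule sum.reindex_bij_witness[of _ "\<lambda>(v, s). (s c, s(c := v))" "\<lambda>(v, s). (s c, s(c := v))"])
       (use assms in \<open>auto simp: PiE_iff extensional_def\<close>)
  also have "\<dots> = (\<Sum>v\<in>S. \<Sum>s\<in>W \<rightarrow>\<^sub>E S. G s)"
    by (rule sum.cartesian_product[symmetric])
  finally show ?thesis by simp
qed

text \<open>The expected number of jumps until two walks at distance \<open>g\<close> meet, if the walk that lags
  behind jumps, is at most \<open>potential L g\<close>: while \<open>g > L\<close> a jump decreases \<open>g\<close> by \<open>(L + 1) / 2\<close> on
  average, and once \<open>g \<le> L\<close> a jump hits the other walk with probability \<open>1 / L\<close>.\<close>

definition potential :: "nat \<Rightarrow> real \<Rightarrow> real" where
  "potential L g = (if g = 0 then 0 else 3 * real L + 2 * g / (real L + 1))"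

lemma potential_nonneg: "g \<ge> 0 \<Longrightarrow> potential L g \<ge> 0"
  by (simp add: potential_def)

text \<open>For \<open>g > L\<close> the mean jump \<open>(L + 1) / 2\<close> lowers the potential
  by exactly 1. For \<open>g \<le> L\<close> the jump \<open>v = g\<close> leads to potential 0 and
  each of the other \<open>L - 1\<close> jumps to at most \<open>3 * L + 2\<close>; the constant 3
  is sufficient since \<open>L + (L - 1) * (3 * L + 2) \<le> 3 * L\<^sup>2\<close>.\<close>

lemma potential_step:
  assumes "L > 0" "g > 0"
  shows "real L + (\<Sum>v = 1..L. potential L \<bar>real v - real g\<bar>) \<le> real L * potential L (real g)"
proof (cases "g > L")
  case True
  have "(\<Sum>v = 1..L. potential L \<bar>real v - real g\<bar>)
      = (\<Sum>v = 1..L. 3 * real L + 2 * real g / (real L + 1) - 2 / (real L + 1) * real v)"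
    using True by (intro sum.cong refl) (auto simp: potential_def diff_divide_distrib right_diff_distrib)
  also have "\<dots> = real L * (3 * real L + 2 * real g / (real L + 1)) - 2 / (real L + 1) * (\<Sum>v = 1..L. real v)"
    by (simp add: sum_subtractf sum_distrib_left)
  also have "(\<Sum>v = 1..L. real v) = real L * (real L + 1) / 2"
    by (induction L) (auto simp: field_simps)
  also have "2 / (real L + 1) * (real L * (real L + 1) / 2) = real L"
    by (simp add: field_simps)
  finally show ?thesis
    using assms by (simp add: potential_def)
next
  case False
  have "(\<Sum>v = 1..L. potential L \<bar>real v - real g\<bar>) = (\<Sum>v\<in>{1..L} - {g}. potential L \<bar>real v - real g\<bar>)"
    using False assms by (subst sum.remove[of _ g]) (auto simp: potential_def)
  also have "\<dots> \<le> (\<Sum>v\<in>{1..L} - {g}. 3 * real L + 2)"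
  proof (rule sum_mono)
    fix v assume v: "v \<in> {1..L} - {g}"
    have "2 * \<bar>real v - real g\<bar> \<le> 2 * (real L + 1)"
    proof -
      have "real v - real g \<le> real L + 1" "real g - real v \<le> real L + 1" using v False by auto
      then have "\<bar>real v - real g\<bar> \<le> real L + 1" by (intro abs_leI) simp_all
      then show ?thesis by simp
    qed
    then have "2 * \<bar>real v - real g\<bar> / (real L + 1) \<le> 2"
      by (subst divide_le_eq) auto
    then show "potential L \<bar>real v - real g\<bar> \<le> 3 * real L + 2"
      by (simp add: potential_def)
  qed
  also have "\<dots> = (real L - 1) * (3 * real L + 2)"
    using False assms by (simp add: card_Diff_singleton of_nat_diff)
  also have "real L + \<dots> \<le> real L * (3 * real L)"
    by (simp add: algebra_simps)
  also have "\<dots> \<le> real L * potential L (real g)"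
    using assms by (intro mult_left_mono) (auto simp: potential_def)
  finally show ?thesis by simp
qed

text \<open>Induction on the total number of jumps, always moving the walk that lags behind, whose
  jump can be resampled. If this is the walk from \<open>a\<close>, it may add one position to the
  difference; if it is the walk from \<open>b\<close>, the excess \<open>m - m'\<close> may grow by
  one. Either way the mean decrease of the potential pays for it.\<close>

lemma sum_card_visited_diff:
  fixes w :: "nat \<Rightarrow> 'w"
  assumes W: "finite W" "range w \<subseteq> W" and L: "L > 0"
    and "inj_on w {min a b..<N}" "a + m * L \<le> N" "b + m' * L \<le> N"
  defines "\<S> \<equiv> W \<rightarrow>\<^sub>E {1..L}"
  shows "(\<Sum>s\<in>\<S>. real (card (visited s w m a - visited s w m' b)))
    \<le> (potential L \<bar>real a - real b\<bar> + real (m - m')) * card \<S>"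
  using assms(4-6)
proof (induction "m + m'" arbitrary: a b m m' rule: less_induct)
  case less
  have fin: "finite \<S>" unfolding \<S>_def using W by (intro finite_PiE) auto
  have trivial_bound: ?case if "\<And>s. card (visited s w m a - visited s w m' b) \<le> m - m'"
  proof -
    have "(\<Sum>s\<in>\<S>. real (card (visited s w m a - visited s w m' b))) \<le> (\<Sum>s\<in>\<S>. real (m - m'))"
      using that by (intro sum_mono) simp
    also have "\<dots> \<le> (potential L \<bar>real a - real b\<bar> + real (m - m')) * card \<S>"
      using potential_nonneg[of "\<bar>real a - real b\<bar>" L] by (simp add: algebra_simps)
    finally show ?thesis .
  qed
  have bound: "s (w i) \<le> L" if "s \<in> \<S>" for s i
    using that W by (auto simp: \<S>_def PiE_iff)
  \<comment> \<open>A walk that starts beyond \<open>c\<close> and stays below \<open>N\<close>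
    never consults the value at \<open>w c\<close>, because \<open>w\<close> is injective
    there.\<close>
  have upd: "visited (s(w c := v)) w l e = visited s w l e"
    if s: "s \<in> \<S>" and c: "c = min a b" "c < e" and e: "e + l * L \<le> N" for s v l e c
  proof (rule visited_cong)
    fix i assume "i \<in> visited s w l e"
    then have "i \<in> {e..<N}"
      using visited_subset[of s w L e l N] bound[OF s] e L by auto
    then have "w i \<noteq> w c"
      using c less.prems(1) by (auto dest!: inj_onD[of w _ i c])
    then show "(s(w c := v)) (w i) = s (w i)" by simp
  qed
  have wW: "w i \<in> W" for i using W by auto
  consider "a = b" | "m = 0" | "m' = 0" | m1 where "a < b" "m = Suc m1" | m1 where "b < a" "m' = Suc m1"
    by (metis linorder_neqE_nat not0_implies_Suc)
  then show ?case
  proof cases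
    case 1
    then show ?thesis using card_visited_diff by (intro trivial_bound) auto
  next
    case 2
    then show ?thesis by (intro trivial_bound) auto
  next
    case 3
    then show ?thesis using card_visited_le by (intro trivial_bound) auto
  next
    case 4
    let ?G = "\<lambda>s. real (card (visited s w m a - visited s w m' b))"
    have "real L * (\<Sum>s\<in>\<S>. ?G s) = (\<Sum>v = 1..L. \<Sum>s\<in>\<S>. ?G (s(w a := v)))"
      using sum_PiE_resample[OF wW[of a], where G = ?G and S = "{1..L}"] by (simp add: \<S>_def)
    also have "\<dots> \<le> (\<Sum>v = 1..L. \<Sum>s\<in>\<S>. 1 + real (card (visited s w m1 (a + v) - visited s w m' b)))"
    proof (intro sum_mono)
      fix v s assume v: "v \<in> {1..L}" and s: "s \<in> \<S>"
      have "visited (s(w a := v)) w m1 (a + v) = visited s w m1 (a + v)"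
        using v 4 less.prems by (intro upd s) auto
      moreover have "visited (s(w a := v)) w m' b = visited s w m' b"
        using 4 less.prems by (intro upd s) auto
      ultimately have "card (visited (s(w a := v)) w m a - visited (s(w a := v)) w m' b)
          \<le> card (insert a (visited s w m1 (a + v) - visited s w m' b))"
        using 4 by (intro card_mono) auto
      also have "\<dots> \<le> 1 + card (visited s w m1 (a + v) - visited s w m' b)"
        using card_insert_le_m1 by (simp add: card_insert_if)
      finally show "?G (s(w a := v)) \<le> 1 + real (card (visited s w m1 (a + v) - visited s w m' b))"
        by linarith
    qed
    also have "\<dots> = (\<Sum>v = 1..L. real (card \<S>)) + (\<Sum>v = 1..L. \<Sum>s\<in>\<S>. real (card (visited s w m1 (a + v) - visited s w m' b)))"
      by (simp add: sum.distrib)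
    also have "\<dots> \<le> (\<Sum>v = 1..L. real (card \<S>)) + (\<Sum>v = 1..L. (potential L \<bar>real (a + v) - real b\<bar> + real (m1 - m')) * card \<S>)"
    proof (intro add_left_mono sum_mono)
      fix v assume v: "v \<in> {1..L}"
      show "(\<Sum>s\<in>\<S>. real (card (visited s w m1 (a + v) - visited s w m' b)))
        \<le> (potential L \<bar>real (a + v) - real b\<bar> + real (m1 - m')) * card \<S>"
        using v 4 less.prems by (intro less.hyps inj_on_subset[OF less.prems(1)]) auto
    qed
    also have "\<dots> = (real L + (\<Sum>v = 1..L. potential L \<bar>real v - real (b - a)\<bar>) + real L * real (m1 - m')) * card \<S>"
      using 4 by (simp add: sum.distrib of_nat_diff algebra_simps flip: sum_distrib_left)
    also have "\<dots> \<le> (real L * potential L (real (b - a)) + real L * real (m - m')) * card \<S>"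
      using 4 potential_step[OF L, of "b - a"] by (intro mult_right_mono add_mono mult_left_mono) auto
    also have "real (b - a) = \<bar>real a - real b\<bar>"
      using 4 by (simp add: of_nat_diff)
    finally have "real L * (\<Sum>s\<in>\<S>. ?G s) \<le> real L * ((potential L \<bar>real a - real b\<bar> + real (m - m')) * card \<S>)"
      by (simp add: algebra_simps)
    then show ?thesis using L by simp
  next
    case 5
    let ?G = "\<lambda>s. real (card (visited s w m a - visited s w m' b))"
    have "real L * (\<Sum>s\<in>\<S>. ?G s) = (\<Sum>v = 1..L. \<Sum>s\<in>\<S>. ?G (s(w b := v)))"
      using sum_PiE_resample[OF wW[of b], where G = ?G and S = "{1..L}"] by (simp add: \<S>_def)
    also have "\<dots> \<le> (\<Sum>v = 1..L. \<Sum>s\<in>\<S>. real (card (visited s w m a - visited s w m1 (b + v))))"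
    proof (intro sum_mono)
      fix v s assume v: "v \<in> {1..L}" and s: "s \<in> \<S>"
      have "visited (s(w b := v)) w m1 (b + v) = visited s w m1 (b + v)"
        using v 5 less.prems by (intro upd s) auto
      moreover have "visited (s(w b := v)) w m a = visited s w m a"
        using 5 less.prems by (intro upd s) auto
      ultimately have "card (visited (s(w b := v)) w m a - visited (s(w b := v)) w m' b)
          \<le> card (visited s w m a - visited s w m1 (b + v))"
        using 5 by (intro card_mono) auto
      then show "?G (s(w b := v)) \<le> real (card (visited s w m a - visited s w m1 (b + v)))"
        by simp
    qed
    also have "\<dots> \<le> (\<Sum>v = 1..L. (potential L \<bar>real a - real (b + v)\<bar> + real (m - m1)) * card \<S>)"
    proof (intro sum_mono)
      fix v assume v: "v \<in> {1..L}"
      show "(\<Sum>s\<in>\<S>. real (card (visited s w m a - visited s w m1 (b + v))))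
        \<le> (potential L \<bar>real a - real (b + v)\<bar> + real (m - m1)) * card \<S>"
        using v 5 less.prems by (intro less.hyps inj_on_subset[OF less.prems(1)]) auto
    qed
    also have "\<dots> = (\<Sum>v = 1..L. (potential L \<bar>real v - real (a - b)\<bar> + real (m - m1)) * card \<S>)"
      using 5 by (intro sum.cong refl arg_cong2[where f = "(*)"] arg_cong2[where f = "(+)"] arg_cong[where f = "potential L"])
        (auto simp: of_nat_diff)
    also have "\<dots> = ((\<Sum>v = 1..L. potential L \<bar>real v - real (a - b)\<bar>) + real L * real (m - m1)) * card \<S>"
      by (simp add: sum.distrib algebra_simps flip: sum_distrib_left)
    also have "\<dots> \<le> ((real L * potential L (real (a - b)) - real L) + real L * (1 + real (m - m'))) * card \<S>"
      using 5 potential_step[OF L, of "a - b"] by (intro mult_right_mono add_mono mult_left_mono) auto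
    also have "real (a - b) = \<bar>real a - real b\<bar>"
      using 5 by (simp add: of_nat_diff)
    finally have "real L * (\<Sum>s\<in>\<S>. ?G s) \<le> real L * ((potential L \<bar>real a - real b\<bar> + real (m - m')) * card \<S>)"
      by (simp add: algebra_simps)
    then show ?thesis using L by simp
  qed
qed

section \<open>Stopping at the position of least random rank\<close>

text \<open>Composing with a transposition shows that every element of \<open>S\<close> is equally
  often the one of least rank, and injectivity of \<open>e\<close> makes these events disjoint. So
  each element is the minimum with probability \<open>1 / card S\<close>.\<close>

lemma card_permutations_min_at:
  fixes e :: "'w \<Rightarrow> nat"
  assumes W: "finite W" and S: "S \<subseteq> W" and e: "inj_on e W" and v: "v \<in> S"
  shows "card S * card {\<pi>. \<pi> permutes W \<and> (\<forall>u\<in>S. e (\<pi> v) \<le> e (\<pi> u))} = card {\<pi>. \<pi> permutes W}"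
proof -
  let ?M = "\<lambda>v. {\<pi>. \<pi> permutes W \<and> (\<forall>u\<in>S. e (\<pi> v) \<le> e (\<pi> u))}"
  have finS: "finite S" using W S by (rule finite_subset[rotated])
  have fin: "finite (?M v)" for v
    by (rule finite_subset[OF _ finite_permutations[OF W]]) auto
  have le: "card (?M v) \<le> card (?M v')" if "v \<in> S" "v' \<in> S" for v v'
  proof (rule card_inj_on_le[where f = "\<lambda>\<pi>. \<pi> \<circ> Transposition.transpose v v'"])
    have tr: "Transposition.transpose v v' permutes W"
      using that S by (auto intro: permutes_swap_id)
    show "inj_on (\<lambda>\<pi>. \<pi> \<circ> Transposition.transpose v v') (?M v)"
      by (rule inj_onI) (metis comp_assoc comp_id transpose_comp_involutory)
    show "(\<lambda>\<pi>. \<pi> \<circ> Transposition.transpose v v') ` ?M v \<subseteq> ?M v'"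
    proof safe
      fix \<pi> assume \<pi>: "\<pi> permutes W" "\<forall>u\<in>S. e (\<pi> v) \<le> e (\<pi> u)"
      show "\<pi> \<circ> Transposition.transpose v v' permutes W" using tr \<pi>(1) by (rule permutes_compose)
      fix u assume "u \<in> S"
      then have "Transposition.transpose v v' u \<in> S" using that by (auto simp: Transposition.transpose_def)
      with \<pi> show "e ((\<pi> \<circ> Transposition.transpose v v') v') \<le> e ((\<pi> \<circ> Transposition.transpose v v') u)" by simp
    qed
  qed (rule fin)
  have "{\<pi>. \<pi> permutes W} = (\<Union>u\<in>S. ?M u)"
  proof safe
    fix \<pi> assume \<pi>: "\<pi> permutes W"
    define u where "u = arg_min_on (\<lambda>u. e (\<pi> u)) S"
    have "u \<in> S" "\<And>u'. u' \<in> S \<Longrightarrow> e (\<pi> u) \<le> e (\<pi> u')"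
      unfolding u_def using finS v by (auto intro: arg_min_if_finite arg_min_least)
    with \<pi> show "\<pi> \<in> (\<Union>u\<in>S. ?M u)" by auto
  qed
  moreover have "card (\<Union>u\<in>S. ?M u) = (\<Sum>u\<in>S. card (?M u))"
  proof (rule card_UN_disjoint[OF finS])
    show "\<forall>u\<in>S. \<forall>u'\<in>S. u \<noteq> u' \<longrightarrow> ?M u \<inter> ?M u' = {}"
    proof (intro ballI impI equals0I)
      fix u u' \<pi> assume u: "u \<in> S" "u' \<in> S" "u \<noteq> u'" and "\<pi> \<in> ?M u \<inter> ?M u'"
      then have \<pi>: "\<pi> permutes W" "e (\<pi> u) = e (\<pi> u')" by (auto intro: antisym)
      then have "\<pi> u = \<pi> u'"
        using u S e by (auto dest!: inj_onD simp: permutes_in_image)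
      with \<pi>(1) u(3) show False
        by (metis permutes_inverses(2))
    qed
  qed (use fin in auto)
  moreover have "(\<Sum>u\<in>S. card (?M u)) = (\<Sum>u\<in>S. card (?M v))"
    using v by (intro sum.cong refl antisym le)
  ultimately show ?thesis by simp
qed

text \<open>For fixed \<open>s\<close>, the walks stop at different places only if the least rank
  over the union of the visited sets is attained in their symmetric difference \<open>D\<close>, an
  event of probability at most \<open>card D / T\<close>. The mean of \<open>card D\<close> over
  \<open>s\<close> is at most twice the potential. The assumption \<open>range\<close> keeps both
  walks within \<open>n\<close> consecutive positions.\<close>

lemma card_stage_failures:
  fixes e :: "bool list \<Rightarrow> nat"
  assumes x: "x \<in> distinct_windows n k" and n: "n > 0" and T: "T > 0" and L: "L > 0"
    and range: "max a b + T * L \<le> min a b + n" and e: "inj e"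
  defines "\<S> \<equiv> bitstrings k \<rightarrow>\<^sub>E {1..L}" and "\<P> \<equiv> {\<pi>. \<pi> permutes bitstrings k}"
  shows "T * card {(s, \<pi>) \<in> \<S> \<times> \<P>. stage n k s (e \<circ> \<pi>) 0 T x a \<noteq> stage n k s (e \<circ> \<pi>) 0 T x b}
    \<le> 2 * potential L \<bar>real a - real b\<bar> * card (\<S> \<times> \<P>)"
proof -
  let ?w = "window n k x"
  let ?F = "\<lambda>s. {\<pi> \<in> \<P>. stage n k s (e \<circ> \<pi>) 0 T x a \<noteq> stage n k s (e \<circ> \<pi>) 0 T x b}"
  let ?A = "\<lambda>s. visited s ?w T a" and ?B = "\<lambda>s. visited s ?w T b"
  have finS: "finite \<S>" unfolding \<S>_def by (intro finite_PiE) auto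
  have finP: "finite \<P>" unfolding \<P>_def by (intro finite_permutations) auto
  have inj: "inj_on ?w {min a b..<min a b + n}"
    by (rule inj_on_window[OF x])
  have one: "T * card (?F s) \<le> (card (?A s - ?B s) + card (?B s - ?A s)) * card \<P>" if s: "s \<in> \<S>" for s
  proof -
    have s1: "s (?w i) \<le> L" "s (?w i) > 0" for i
      using PiE_mem[OF s[unfolded \<S>_def], of "?w i"] by auto
    have sub: "?A s \<subseteq> {min a b..<min a b + n}" "?B s \<subseteq> {min a b..<min a b + n}"
    proof -
      have *: "a + T * L \<le> min a b + n" "b + T * L \<le> min a b + n"
        using range by linarith+
      have "?A s \<subseteq> {a..<min a b + n}"
        by (rule visited_subset[OF _ *(1) L]) (rule s1)
      moreover have "?B s \<subseteq> {b..<min a b + n}"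
        by (rule visited_subset[OF _ *(2) L]) (rule s1)
      ultimately show "?A s \<subseteq> {min a b..<min a b + n}" "?B s \<subseteq> {min a b..<min a b + n}"
        by (elim order.trans; simp)+
    qed
    define D where "D = (?A s - ?B s) \<union> (?B s - ?A s)"
    define S where "S = ?w ` (?A s \<union> ?B s)"
    let ?M = "\<lambda>v. {\<pi>. \<pi> permutes bitstrings k \<and> (\<forall>u\<in>S. e (\<pi> v) \<le> e (\<pi> u))}"
    \<comment> \<open>The smaller of the two minima is the minimum over the union. Only one walk
      visits it, since the other would otherwise have reached a rank as small.\<close>
    have "?F s \<subseteq> (\<Union>v\<in>?w ` D. ?M v)"
    proof
      fix \<pi> assume \<pi>: "\<pi> \<in> ?F s"
      obtain i where i: "i \<in> {0..<T}" "stage n k s (e \<circ> \<pi>) 0 T x a = walk n k s x i a"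
        "\<And>i'. i' \<in> {0..<T} \<Longrightarrow> (e \<circ> \<pi>) (?w (walk n k s x i a)) \<le> (e \<circ> \<pi>) (?w (walk n k s x i' a))"
        by (rule stage_minimal[OF T, of n k s "e \<circ> \<pi>" x a]) blast
      obtain j where j: "j \<in> {0..<T}" "stage n k s (e \<circ> \<pi>) 0 T x b = walk n k s x j b"
        "\<And>j'. j' \<in> {0..<T} \<Longrightarrow> (e \<circ> \<pi>) (?w (walk n k s x j b)) \<le> (e \<circ> \<pi>) (?w (walk n k s x j' b))"
        by (rule stage_minimal[OF T, of n k s "e \<circ> \<pi>" x b]) blast
      define p q where "p = walk n k s x i a" and "q = walk n k s x j b"
      have p: "p \<in> ?A s" "\<And>p'. p' \<in> ?A s \<Longrightarrow> e (\<pi> (?w p)) \<le> e (\<pi> (?w p'))"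
        using i(1,3) by (auto simp: visited_eq p_def)
      have q: "q \<in> ?B s" "\<And>q'. q' \<in> ?B s \<Longrightarrow> e (\<pi> (?w q)) \<le> e (\<pi> (?w q'))"
        using j(1,3) by (auto simp: visited_eq q_def)
      have neq: "p \<noteq> q" using \<pi> i(2) j(2) by (auto simp: p_def q_def)
      have \<pi>p: "\<pi> permutes bitstrings k" using \<pi> by (auto simp: \<P>_def)
      have ne: "e (\<pi> (?w p)) \<noteq> e (\<pi> (?w q))"
      proof
        assume "e (\<pi> (?w p)) = e (\<pi> (?w q))"
        then have "?w p = ?w q"
          using e \<pi>p by (metis injD permutes_inj)
        with neq sub p(1) q(1) inj show False by (auto dest: inj_onD)
      qed
      show "\<pi> \<in> (\<Union>v\<in>?w ` D. ?M v)"
      proof (cases "e (\<pi> (?w p)) < e (\<pi> (?w q))")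
        case True
        with q(2)[of p] p(1) have "p \<in> D" by (force simp: D_def)
        moreover have "\<pi> \<in> ?M (?w p)"
          using True p(2) q(2) \<pi>p by (fastforce simp: S_def)
        ultimately show ?thesis by blast
      next
        case False
        with ne have "e (\<pi> (?w q)) < e (\<pi> (?w p))" by simp
        moreover from this p(2)[of q] q(1) have "q \<in> D" by (force simp: D_def)
        moreover have "\<pi> \<in> ?M (?w q)"
          using calculation(1) p(2) q(2) \<pi>p by (fastforce simp: S_def)
        ultimately show ?thesis by blast
      qed
    qed
    then have "card (?F s) \<le> card (\<Union>v\<in>?w ` D. ?M v)"
      by (intro card_mono finite_UN_I) (auto simp: D_def intro: finite_subset[OF _ finP] simp: \<P>_def)
    also have "\<dots> \<le> (\<Sum>v\<in>?w ` D. card (?M v))"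
      by (rule card_UN_le) (simp add: D_def)
    finally have "card S * card (?F s) \<le> (\<Sum>v\<in>?w ` D. card S * card (?M v))"
      by (simp flip: sum_distrib_left)
    also have "\<dots> = (\<Sum>v\<in>?w ` D. card \<P>)"
      unfolding \<P>_def
      by (intro sum.cong refl card_permutations_min_at)
         (use e in \<open>auto simp: S_def D_def intro: inj_on_subset\<close>)
    also have "\<dots> \<le> card D * card \<P>"
      using card_image_le[of D ?w] by (simp add: D_def)
    also have "card D = card (?A s - ?B s) + card (?B s - ?A s)"
      unfolding D_def by (rule card_Un_disjoint) auto
    finally have *: "card S * card (?F s) \<le> (card (?A s - ?B s) + card (?B s - ?A s)) * card \<P>" .
    \<comment> \<open>Steps are positive, so a single walk already visits \<open>T\<close> different
      positions.\<close>
    have "T = card (?A s)" using card_visited[of s ?w T a] s1 by simp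
    also have "\<dots> \<le> card (?A s \<union> ?B s)" by (intro card_mono) auto
    also have "\<dots> = card S"
      unfolding S_def using sub by (intro card_image[symmetric] inj_on_subset[OF inj]) auto
    finally have "T * card (?F s) \<le> card S * card (?F s)" by (rule mult_right_mono) simp
    with * show ?thesis by linarith
  qed
  have "{(s, \<pi>) \<in> \<S> \<times> \<P>. stage n k s (e \<circ> \<pi>) 0 T x a \<noteq> stage n k s (e \<circ> \<pi>) 0 T x b} = Sigma \<S> ?F"
    by auto
  then have "T * card {(s, \<pi>) \<in> \<S> \<times> \<P>. stage n k s (e \<circ> \<pi>) 0 T x a \<noteq> stage n k s (e \<circ> \<pi>) 0 T x b}
      = (\<Sum>s\<in>\<S>. T * card (?F s))"
    using finS finP by (simp add: card_SigmaI sum_distrib_left)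
  also have "\<dots> \<le> (\<Sum>s\<in>\<S>. (card (?A s - ?B s) + card (?B s - ?A s)) * card \<P>)"
    by (intro sum_mono one)
  finally have "real (T * card {(s, \<pi>) \<in> \<S> \<times> \<P>. stage n k s (e \<circ> \<pi>) 0 T x a \<noteq> stage n k s (e \<circ> \<pi>) 0 T x b})
      \<le> real (\<Sum>s\<in>\<S>. (card (?A s - ?B s) + card (?B s - ?A s)) * card \<P>)"
    by (rule of_nat_mono)
  also have "\<dots> = ((\<Sum>s\<in>\<S>. real (card (?A s - ?B s))) + (\<Sum>s\<in>\<S>. real (card (?B s - ?A s)))) * card \<P>"
    by (simp add: sum.distrib distrib_right sum_distrib_right)
  also have "\<dots> \<le> (potential L \<bar>real a - real b\<bar> * card \<S> + potential L \<bar>real a - real b\<bar> * card \<S>) * card \<P>"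
  proof (intro mult_right_mono add_mono)
    have *: "a + T * L \<le> min a b + n" "b + T * L \<le> min a b + n"
      using range by auto
    have rw: "range ?w \<subseteq> bitstrings k" by auto
    show "(\<Sum>s\<in>\<S>. real (card (?A s - ?B s))) \<le> potential L \<bar>real a - real b\<bar> * card \<S>"
      using sum_card_visited_diff[of "bitstrings k" ?w L a b "min a b + n" T T] * inj L rw
      by (auto simp: \<S>_def)
    show "(\<Sum>s\<in>\<S>. real (card (?B s - ?A s))) \<le> potential L \<bar>real a - real b\<bar> * card \<S>"
      using sum_card_visited_diff[of "bitstrings k" ?w L b a "min a b + n" T T] * inj L rw
      by (auto simp: \<S>_def min.commute abs_minus_commute)
  qed simp
  finally show ?thesis
    by (simp add: card_cartesian_product algebra_simps)
qed

text \<open>Double counting removes the randomness: \<open>X\<close> holds the random choices and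
  \<open>Y\<close> the inputs, and some single choice fails on no larger a fraction of the inputs
  than is allowed for each input on average.\<close>

lemma averaging:
  fixes c t :: real
  assumes "finite X" "X \<noteq> {}" "finite Y"
    and le: "\<And>y. y \<in> Y \<Longrightarrow> t * card {x \<in> X. P x y} \<le> c * card X"
  shows "\<exists>x\<in>X. t * card {y \<in> Y. P x y} \<le> c * card Y"
proof (rule ccontr)
  assume "\<not> ?thesis"
  then have "(\<Sum>x\<in>X. c * card Y) < (\<Sum>x\<in>X. t * card {y \<in> Y. P x y})"
    using assms by (intro sum_strict_mono) (auto simp: not_le)
  also have "\<dots> = (\<Sum>y\<in>Y. t * card {x \<in> X. P x y})"
  proof -
    have "(\<Sum>x\<in>X. card {y \<in> Y. P x y}) = (\<Sum>y\<in>Y. card {x \<in> X. P x y})"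
      using assms by (intro sum_multicount_gen) auto
    then have "real (\<Sum>x\<in>X. card {y \<in> Y. P x y}) = real (\<Sum>y\<in>Y. card {x \<in> X. P x y})"
      by simp
    then show ?thesis by (simp flip: sum_distrib_left)
  qed
  also have "\<dots> \<le> (\<Sum>y\<in>Y. c * card X)"
    by (intro sum_mono le)
  finally show False by (simp add: mult_ac)
qed

section \<open>Iterated walks\<close>

lemma walk_bounds:
  assumes "\<And>w. w \<in> bitstrings k \<Longrightarrow> s w \<le> L"
  shows "a \<le> walk n k s x j a" "walk n k s x j a \<le> a + j * L"
proof -
  show "a \<le> walk n k s x j a" by (induction j) auto
  show "walk n k s x j a \<le> a + j * L"
  proof (induction j)
    case (Suc j)
    then show ?case using assms[of "window n k x (walk n k s x j a)"] by simp
  qed simp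
qed

text \<open>Starting at 0 on the shifted string amounts to starting at 1 on the original one. The
  hash condition thus becomes agreement of the results from the starts 0 and 1 on the same
  string.\<close>

definition shift_equivariant :: "nat \<Rightarrow> (bool list \<Rightarrow> nat \<Rightarrow> nat) \<Rightarrow> bool" where
  "shift_equivariant n g \<longleftrightarrow> (\<forall>x\<in>bitstrings n. \<forall>a. Suc (g (rotate1 x) a) = g x (Suc a))"

definition disagreements :: "nat \<Rightarrow> nat \<Rightarrow> (bool list \<Rightarrow> nat \<Rightarrow> nat) \<Rightarrow> bool list set" where
  "disagreements n k g = {x \<in> distinct_windows n k. g x 0 \<noteq> g x 1}"

lemma finite_distinct_windows [simp]: "finite (distinct_windows n k)"
  by (rule finite_subset[OF _ finite_bitstrings[of n]]) (auto simp: distinct_windows_def)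

text \<open>An error is either a disagreement on a string with distinct windows or a string with a
  repeated window; the latter account for the summand \<open>n\<^sup>2 / 2 ^ k\<close>.\<close>

lemma card_errors_le:
  fixes c :: real
  assumes g: "shift_equivariant n g" and n: "2 * k \<le> n" "n > 0"
    and D: "card {x \<in> distinct_windows n k. g x 0 mod n \<noteq> g x 1 mod n} \<le> c * 2 ^ n"
  shows "card (errors n (\<lambda>x. g x 0 mod n)) \<le> (c + real n ^ 2 / 2 ^ k) * 2 ^ n"
proof -
  let ?D = "{x \<in> distinct_windows n k. g x 0 mod n \<noteq> g x 1 mod n}"
  have "errors n (\<lambda>x. g x 0 mod n) \<subseteq> ?D \<union> (bitstrings n - distinct_windows n k)"
  proof
    fix x assume x: "x \<in> errors n (\<lambda>x. g x 0 mod n)"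
    then have "Suc (g (rotate1 x) 0) = g x 1"
      using g by (simp add: shift_equivariant_def errors_def)
    then have "(g (rotate1 x) 0 mod n + 1) mod n = g x 1 mod n"
      by (metis Suc_eq_plus1 mod_add_left_eq)
    with x show "x \<in> ?D \<union> (bitstrings n - distinct_windows n k)"
      by (auto simp: errors_def)
  qed
  then have "card (errors n (\<lambda>x. g x 0 mod n)) \<le> card (?D \<union> (bitstrings n - distinct_windows n k))"
    by (intro card_mono) auto
  also have "\<dots> \<le> card ?D + card (bitstrings n - distinct_windows n k)"
    by (rule card_Un_le)
  also have "\<dots> \<le> card ?D + n * n * 2 ^ (n - k)"
    using card_not_distinct_windows[OF n] by simp
  finally have "real (card (errors n (\<lambda>x. g x 0 mod n))) \<le> real (card ?D + n * n * 2 ^ (n - k))"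
    by (rule of_nat_mono)
  also have "\<dots> \<le> c * 2 ^ n + real n * real n * 2 ^ (n - k)"
    using D by simp
  also have "real n * real n * 2 ^ (n - k) = real n ^ 2 / 2 ^ k * 2 ^ n"
    using n(1) by (simp add: power2_eq_square power_diff)
  finally show ?thesis by (simp add: algebra_simps)
qed

text \<open>One stage is appended to \<open>g\<close>. Starts that \<open>g\<close> has already
  identified stay identified, so \<open>s\<close> and \<open>\<pi>\<close> are averaged only over
  the remaining disagreements and then fixed. A stage moves forward by at most \<open>T * L\<close>,
  which bounds the new distance.\<close>

lemma exists_refined_stage:
  fixes D :: real
  assumes n: "n > 0" and T: "T > 0" and L: "L > 0"
    and g: "shift_equivariant n g" "\<And>a. query_computable n q (\<lambda>x. g x a)"
      "\<And>x. x \<in> bitstrings n \<Longrightarrow> \<bar>real (g x 0) - real (g x 1)\<bar> \<le> D"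
    and range: "D + real T * real L \<le> real n"
  shows "\<exists>g'. shift_equivariant n g' \<and> (\<forall>a. query_computable n (q + T * k) (\<lambda>x. g' x a))
    \<and> (\<forall>x\<in>bitstrings n. \<bar>real (g' x 0) - real (g' x 1)\<bar> \<le> D + real T * real L)
    \<and> real T * card (disagreements n k g')
        \<le> 2 * (3 * real L + 2 * D / (real L + 1)) * card (disagreements n k g)"
proof -
  define \<S> where "\<S> = bitstrings k \<rightarrow>\<^sub>E {1..L}"
  define \<P> where "\<P> = {\<pi>. \<pi> permutes bitstrings k}"
  define e where "e = (to_nat :: bool list \<Rightarrow> nat)"
  have finS: "finite \<S>" unfolding \<S>_def by (intro finite_PiE) auto
  have neS: "\<S> \<noteq> {}" unfolding \<S>_def using L by (auto simp: PiE_eq_empty_iff)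
  have finP: "finite \<P>" unfolding \<P>_def by (intro finite_permutations) auto
  have neP: "\<P> \<noteq> {}" unfolding \<P>_def using permutes_id[of "bitstrings k"] by blast
  have e: "inj e" by (simp add: e_def)
  let ?h = "\<lambda>(s, \<pi>) x a. stage n k s (e \<circ> \<pi>) 0 T x (g x a)"
  let ?c = "2 * (3 * real L + 2 * D / (real L + 1))"
  have "\<exists>z\<in>\<S> \<times> \<P>. real T * card {x \<in> disagreements n k g. ?h z x 0 \<noteq> ?h z x 1}
      \<le> ?c * card (disagreements n k g)"
  proof (rule averaging)
    fix x assume x: "x \<in> disagreements n k g"
    then have xd: "x \<in> distinct_windows n k" and neq: "g x 0 \<noteq> g x 1"
      by (auto simp: disagreements_def)
    have d: "\<bar>real (g x 0) - real (g x 1)\<bar> \<le> D"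
      using g(3) xd by (auto simp: distinct_windows_def)
    have "real (max (g x 0) (g x 1) + T * L) \<le> real (min (g x 0) (g x 1) + n)"
      using d range by (auto simp: max_def min_def)
    then have r: "max (g x 0) (g x 1) + T * L \<le> min (g x 0) (g x 1) + n"
      by (simp only: of_nat_le_iff)
    have "real T * card {z \<in> \<S> \<times> \<P>. ?h z x 0 \<noteq> ?h z x 1}
        = real T * card {(s, \<pi>) \<in> \<S> \<times> \<P>. stage n k s (e \<circ> \<pi>) 0 T x (g x 0) \<noteq> stage n k s (e \<circ> \<pi>) 0 T x (g x 1)}"
      by (intro arg_cong[where f = "\<lambda>A. real T * card A"]) auto
    also have "\<dots> \<le> 2 * potential L \<bar>real (g x 0) - real (g x 1)\<bar> * card (\<S> \<times> \<P>)"
      unfolding \<S>_def \<P>_def using card_stage_failures[OF xd n T L r e] by simp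
    also have "\<dots> \<le> ?c * card (\<S> \<times> \<P>)"
    proof (intro mult_right_mono mult_left_mono)
      have "2 * \<bar>real (g x 0) - real (g x 1)\<bar> / (real L + 1) \<le> 2 * D / (real L + 1)"
        using d by (intro divide_right_mono) auto
      with neq show "potential L \<bar>real (g x 0) - real (g x 1)\<bar> \<le> 3 * real L + 2 * D / (real L + 1)"
        by (simp add: potential_def)
    qed auto
    finally show "real T * card {z \<in> \<S> \<times> \<P>. ?h z x 0 \<noteq> ?h z x 1} \<le> ?c * card (\<S> \<times> \<P>)"
      by simp
  next
    show "finite (disagreements n k g)" by (simp add: disagreements_def)
  qed (use finS finP neS neP in auto)
  then obtain s \<pi> where s: "s \<in> \<S>" and
    le: "real T * card {x \<in> disagreements n k g. ?h (s, \<pi>) x 0 \<noteq> ?h (s, \<pi>) x 1} \<le> ?c * card (disagreements n k g)"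
    by blast
  define g' where "g' = (\<lambda>x a. stage n k s (e \<circ> \<pi>) 0 T x (g x a))"
  have "shift_equivariant n g'"
    using g(1) n by (simp add: shift_equivariant_def g'_def stage_rotate1)
  moreover have "query_computable n (q + T * k) (\<lambda>x. g' x a)" for a
    unfolding g'_def by (rule query_computable_bind[OF g(2) query_computable_stage[OF n]])
  moreover have "\<bar>real (g' x 0) - real (g' x 1)\<bar> \<le> D + real T * real L" if x: "x \<in> bitstrings n" for x
  proof -
    have b: "g x a \<le> g' x a \<and> g' x a \<le> g x a + T * L" for a
    proof -
      obtain j where j: "j \<in> {0..<T}" "g' x a = walk n k s x j (g x a)"
        unfolding g'_def by (rule stage_minimal[OF T, of n k s "e \<circ> \<pi>" x "g x a"]) blast
      have "s w \<le> L" if "w \<in> bitstrings k" for w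
        using PiE_mem[OF s[unfolded \<S>_def] that] by simp
      note wb = walk_bounds[of k s L, OF this, where n = n and x = x and j = j and a = "g x a"]
      have "j * L \<le> T * L" using j(1) by (intro mult_right_mono) auto
      with wb j(2) show ?thesis by linarith
    qed
    have "real (g x a) \<le> real (g' x a) \<and> real (g' x a) \<le> real (g x a) + real T * real L" for a
    proof -
      have "real (g' x a) \<le> real (g x a + T * L)" using b[of a] by (simp only: of_nat_le_iff)
      then show ?thesis using b[of a] by simp
    qed
    from this[of 0] this[of 1] g(3)[OF x] show ?thesis by linarith
  qed
  moreover have "disagreements n k g' \<subseteq> {x \<in> disagreements n k g. ?h (s, \<pi>) x 0 \<noteq> ?h (s, \<pi>) x 1}"
    by (auto simp: disagreements_def g'_def)
  then have "card (disagreements n k g') \<le> card {x \<in> disagreements n k g. ?h (s, \<pi>) x 0 \<noteq> ?h (s, \<pi>) x 1}"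
    by (intro card_mono) (auto simp: disagreements_def)
  then have "real T * card (disagreements n k g') \<le> real T * card {x \<in> disagreements n k g. ?h (s, \<pi>) x 0 \<noteq> ?h (s, \<pi>) x 1}"
    by (intro mult_left_mono) auto
  then have "real T * card (disagreements n k g') \<le> ?c * card (disagreements n k g)"
    using le by linarith
  ultimately show ?thesis by blast
qed

text \<open>In closed form this is \<open>t\<close> to the power \<open>1 - 1 / 2 ^ j\<close>. It
  serves as the approximate step length of stage \<open>j\<close>, and its square, up to a factor 4,
  as the distance before that stage.\<close>

primrec scale :: "real \<Rightarrow> nat \<Rightarrow> real" where
  "scale t 0 = 1"
| "scale t (Suc j) = sqrt (scale t j * t)"

lemma scale_ge_1: "t \<ge> 1 \<Longrightarrow> scale t j \<ge> 1"
proof (induction j)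
  case (Suc j)
  then have "1 * 1 \<le> scale t j * t" by (intro mult_mono) auto
  then show ?case by simp
qed simp

lemma scale_Suc_sqr: "t \<ge> 1 \<Longrightarrow> scale t (Suc j) ^ 2 = scale t j * t"
  using scale_ge_1[of t j] by simp

lemma scale_power: "t \<ge> 1 \<Longrightarrow> (t / scale t j) ^ (2 ^ j) = t"
proof (induction j)
  case (Suc j)
  have "(t / scale t (Suc j)) ^ (2 ^ Suc j) = ((t / scale t (Suc j)) ^ 2) ^ (2 ^ j)"
    by (simp add: power_mult)
  also have "(t / scale t (Suc j)) ^ 2 = t / scale t j"
    using scale_ge_1[of t j] Suc.prems by (simp only: power_divide scale_Suc_sqr) (simp add: power2_eq_square)
  finally show ?case using Suc by simp
qed simp

text \<open>With \<open>X = scale T j\<close>, distances are at most \<open>4 * X\<^sup>2\<close>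
  and the fraction of disagreements at most \<open>28 ^ j / X\<^sup>2\<close>. A stage with
  \<open>L\<close> close to \<open>X\<close> multiplies the first bound by \<open>T / X\<close> and
  the second by \<open>28 * X / T\<close>.\<close>

lemma exists_stages:
  assumes n: "n > 0" "4 * T ^ 2 \<le> n" and T: "T > 0" and K: "\<And>i. i < K \<Longrightarrow> 2 ^ 2 ^ i < T" and "j \<le> K"
  shows "\<exists>g. shift_equivariant n g \<and> (\<forall>a. query_computable n (j * (T * k)) (\<lambda>x. g x a))
    \<and> (\<forall>x\<in>bitstrings n. \<bar>real (g x 0) - real (g x 1)\<bar> \<le> 4 * scale T j ^ 2)
    \<and> card (disagreements n k g) * scale T j ^ 2 \<le> 28 ^ j * 2 ^ n"
  using assms(5)
proof (induction j)
  case 0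
  have "card (disagreements n k (\<lambda>x a. a)) \<le> card (bitstrings n)"
    by (intro card_mono) (auto simp: disagreements_def distinct_windows_def)
  then have "real (card (disagreements n k (\<lambda>x a. a))) \<le> 2 ^ n"
    by (simp flip: of_nat_le_iff)
  then show ?case
    by (intro exI[of _ "\<lambda>x a. a"]) (auto simp: shift_equivariant_def query_computable_const)
next
  case (Suc j)
  have T1: "real T \<ge> 1" using T by simp
  define X where "X = scale (real T) j"
  have X1: "X \<ge> 1" unfolding X_def by (rule scale_ge_1[OF T1])
  \<comment> \<open>The quotient \<open>T / X\<close> is the root of \<open>T\<close> of order
    \<open>2 ^ j\<close>, and it exceeds 2 by the choice of \<open>K\<close>.\<close>
  have X2: "2 * X \<le> real T"
  proof -
    have "(2::nat) ^ 2 ^ j < T" using K Suc.prems by simp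
    then have "(2::real) ^ 2 ^ j < real T" by (simp flip: of_nat_less_iff)
    also have "\<dots> = (real T / X) ^ 2 ^ j" unfolding X_def by (rule scale_power[OF T1, symmetric])
    finally have "2 < real T / X" by (rule power_less_imp_less_base) (use X1 in simp)
    then show ?thesis using X1 by (simp add: field_simps)
  qed
  have X': "scale (real T) (Suc j) ^ 2 = X * real T"
    unfolding X_def by (rule scale_Suc_sqr[OF T1])
  define L where "L = nat \<lceil>X\<rceil>"
  have L: "L > 0" "X \<le> real L" "real L \<le> 2 * X"
    using X1 unfolding L_def by linarith+
  obtain g where g: "shift_equivariant n g" "\<And>a. query_computable n (j * (T * k)) (\<lambda>x. g x a)"
    "\<And>x. x \<in> bitstrings n \<Longrightarrow> \<bar>real (g x 0) - real (g x 1)\<bar> \<le> 4 * X ^ 2"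
    "card (disagreements n k g) * X ^ 2 \<le> 28 ^ j * 2 ^ n"
    using Suc by (auto simp: X_def)
  have XX: "X * (2 * X) \<le> X * real T" using X1 X2 by (intro mult_left_mono) auto
  have TL: "real T * real L \<le> real T * (2 * X)" using L by (intro mult_left_mono) auto
  have D: "4 * X ^ 2 + real T * real L \<le> 4 * (X * real T)"
  proof -
    have "X * (2 * X) = 2 * X ^ 2" "real T * (2 * X) = 2 * (X * real T)"
      by (simp_all add: power2_eq_square)
    with XX TL show ?thesis by linarith
  qed
  have "4 * (X * real T) \<le> 2 * (real T * real T)"
    using X2 mult_right_mono[OF X2, of "real T"] by simp
  also have "\<dots> \<le> real n"
    using of_nat_mono[OF n(2), where 'a = real] by (simp add: power2_eq_square)
  finally have r: "4 * X ^ 2 + real T * real L \<le> real n" using D by linarith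
  obtain g' where g': "shift_equivariant n g'" "\<And>a. query_computable n (j * (T * k) + T * k) (\<lambda>x. g' x a)"
    "\<And>x. x \<in> bitstrings n \<Longrightarrow> \<bar>real (g' x 0) - real (g' x 1)\<bar> \<le> 4 * X ^ 2 + real T * real L"
    "real T * card (disagreements n k g')
        \<le> 2 * (3 * real L + 2 * (4 * X ^ 2) / (real L + 1)) * card (disagreements n k g)"
    using exists_refined_stage[OF n(1) T L(1) g(1-3) r, of k] by auto
  \<comment> \<open>The factor 28 is twice the sum of 6, from \<open>L \<le> 2 * X\<close>, and 8,
    from the distance term.\<close>
  have "2 * (4 * X ^ 2) / (real L + 1) \<le> 8 * X ^ 2 / X"
    using L(2) X1 by (intro frac_le) auto
  also have "\<dots> = 8 * X" using X1 by (simp add: power2_eq_square)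
  finally have "2 * (4 * X ^ 2) / (real L + 1) \<le> 8 * X" .
  with L(3) have "3 * real L + 2 * (4 * X ^ 2) / (real L + 1) \<le> 3 * (2 * X) + 8 * X"
    by (intro add_mono) auto
  then have "2 * (3 * real L + 2 * (4 * X ^ 2) / (real L + 1)) \<le> 28 * X" by simp
  then have "2 * (3 * real L + 2 * (4 * X ^ 2) / (real L + 1)) * card (disagreements n k g)
      \<le> 28 * X * card (disagreements n k g)"
    by (rule mult_right_mono) simp
  with g'(4) have "real T * card (disagreements n k g') \<le> 28 * X * card (disagreements n k g)"
    by simp
  then have "X * (real T * card (disagreements n k g')) \<le> X * (28 * X * card (disagreements n k g))"
    using X1 by (intro mult_left_mono) auto
  also have "\<dots> \<le> 28 * (28 ^ j * 2 ^ n)"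
    using g(4) by (simp add: power2_eq_square mult_ac)
  finally have "card (disagreements n k g') * scale (real T) (Suc j) ^ 2 \<le> 28 ^ Suc j * 2 ^ n"
    unfolding X' by (simp add: mult_ac)
  moreover have "\<bar>real (g' x 0) - real (g' x 1)\<bar> \<le> 4 * scale (real T) (Suc j) ^ 2"
    if "x \<in> bitstrings n" for x
    using g'(3)[OF that] D unfolding X' by linarith
  moreover have "Suc j * (T * k) = j * (T * k) + T * k" by simp
  ultimately show ?case using g'(1,2) by metis
qed

text \<open>After \<open>K\<close> stages \<open>T / X \<le> 2\<close>, so the error bound with
  \<open>X\<^sup>2\<close> in the denominator turns into one with \<open>T\<^sup>2\<close> at the
  cost of a factor 4.\<close>

lemma exists_lphs_stages:
  assumes n: "n > 0" "4 * T ^ 2 \<le> n" "2 * k \<le> n" and T: "T > 0"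
    and K: "\<And>i. i < K \<Longrightarrow> 2 ^ 2 ^ i < T" "T \<le> 2 ^ 2 ^ K"
  shows "\<exists>h. lphs n (K * (T * k)) (4 * 28 ^ K / real T ^ 2 + real n ^ 2 / 2 ^ k) (return_pmf h)"
proof -
  have T1: "real T \<ge> 1" using T by simp
  define X where "X = scale (real T) K"
  have X1: "X \<ge> 1" unfolding X_def by (rule scale_ge_1[OF T1])
  have "(real T / X) ^ 2 ^ K = real T" unfolding X_def by (rule scale_power[OF T1])
  also have "\<dots> \<le> 2 ^ 2 ^ K" using of_nat_mono[OF K(2), where 'a = real] by simp
  finally have "real T / X \<le> 2"
    using power_strict_mono[of 2 "real T / X" "2 ^ K"] by (cases "real T / X \<le> 2") auto
  then have "real T \<le> 2 * X" using X1 by (simp add: field_simps)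
  then have TX: "real T ^ 2 \<le> 4 * X ^ 2" using power_mono[of "real T" "2 * X" 2] by (simp add: power_mult_distrib)
  obtain g where g: "shift_equivariant n g" "\<And>a. query_computable n (K * (T * k)) (\<lambda>x. g x a)"
    "card (disagreements n k g) * X ^ 2 \<le> 28 ^ K * 2 ^ n"
    using exists_stages[of n T K K k] n T K(1) unfolding X_def by blast
  have "card (disagreements n k g) * real T ^ 2 \<le> card (disagreements n k g) * (4 * X ^ 2)"
    using TX by (rule mult_left_mono) simp
  also have "\<dots> \<le> 4 * (28 ^ K * 2 ^ n)" using g(3) by simp
  finally have "card (disagreements n k g) \<le> 4 * 28 ^ K / real T ^ 2 * 2 ^ n"
    using T by (simp add: field_simps)
  moreover have "card {x \<in> distinct_windows n k. g x 0 mod n \<noteq> g x 1 mod n} \<le> card (disagreements n k g)"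
    by (intro card_mono) (auto simp: disagreements_def)
  ultimately have "card {x \<in> distinct_windows n k. g x 0 mod n \<noteq> g x 1 mod n} \<le> 4 * 28 ^ K / real T ^ 2 * 2 ^ n"
    by linarith
  from card_errors_le[OF g(1) n(3,1) this]
  have "lphs n (K * (T * k)) (4 * 28 ^ K / real T ^ 2 + real n ^ 2 / 2 ^ k) (return_pmf (\<lambda>x. g x 0 mod n))"
    unfolding lphs_return_pmf using n(1) query_computable_map[OF g(2)[of 0]] by auto
  then show ?thesis by blast
qed

lemma lphs_trivial: "n > 0 \<Longrightarrow> \<delta> \<ge> 1 \<Longrightarrow> lphs n d \<delta> (return_pmf (\<lambda>x. 0))"
proof -
  assume n: "n > 0" and d: "\<delta> \<ge> 1"
  have "card (errors n (\<lambda>x. 0)) \<le> card (bitstrings n)"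
    by (intro card_mono) (auto simp: errors_def)
  then have "real (card (errors n (\<lambda>x. 0))) \<le> 1 * 2 ^ n" by (simp flip: of_nat_le_iff)
  also have "\<dots> \<le> \<delta> * 2 ^ n" using d by (intro mult_right_mono) auto
  finally show "lphs n d \<delta> (return_pmf (\<lambda>x. 0))"
    unfolding lphs_return_pmf using n query_computable_mono[OF query_computable_const, of d] by auto
qed

lemma lphs_mono_error: "lphs n d \<delta> H \<Longrightarrow> \<delta> \<le> \<delta>' \<Longrightarrow> lphs n d \<delta>' H"
  by (auto simp: lphs_def)

section \<open>Parameters for a given number of queries\<close>

definition logsize :: "nat \<Rightarrow> nat" where
  "logsize n = nat \<lceil>log 2 (real n)\<rceil> + 1"

lemma logsize_pos [simp]: "logsize n > 0"
  by (simp add: logsize_def)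

lemma le_two_power_logsize: "n \<le> 2 ^ logsize n"
proof (cases "n = 0")
  case False
  have "log 2 (real n) \<le> real (logsize n)"
    unfolding logsize_def by linarith
  then have "real n \<le> 2 powr real (logsize n)"
    using False by (simp add: log_le_iff)
  then have "real n \<le> real (2 ^ logsize n)"
    by (simp add: powr_realpow)
  then show ?thesis by (simp only: of_nat_le_iff)
qed simp

text \<open>With \<open>b = logsize n\<close>, at most \<open>b\<close> stages of \<open>T\<close>
  jumps and windows of length \<open>4 * b\<close> fit into \<open>d\<close> queries if
  \<open>T = d div (4 * b\<^sup>2)\<close>. The constant is \<open>8192 = 4 * 32 * 64\<close>, from
  the stages, from \<open>28 ^ K \<le> 32 * b ^ 5\<close> and from
  \<open>d \<le> 8 * b\<^sup>2 * T\<close>. For \<open>d < 4 * b\<^sup>2\<close> the claimed bound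
  is at least 1.\<close>

lemma exists_lphs_inverse_square:
  assumes n: "n > 0" and d: "d > 0" "real d \<le> sqrt (real n)"
  shows "\<exists>h. lphs n d ((8192 * real (logsize n) ^ 9 + 1) / real d ^ 2) (return_pmf h)"
proof -
  define b where "b = logsize n"
  have b1: "b \<ge> 1" unfolding b_def by (simp add: Suc_leI)
  have b1': "real b \<ge> 1" using b1 by simp
  have nb: "n \<le> 2 ^ b" unfolding b_def by (rule le_two_power_logsize)
  have dn: "d ^ 2 \<le> n"
    using power_mono[OF d(2), of 2] by (simp flip: of_nat_power)
  show ?thesis
  proof (cases "d < 4 * b ^ 2")
    case True
    have "real d \<le> 4 * real b ^ 2"
      using True by (simp flip: of_nat_power) 
    then have "real d ^ 2 \<le> (4 * real b ^ 2) ^ 2" by (intro power_mono) auto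
    also have "\<dots> = 16 * real b ^ 4" by (simp add: power_mult_distrib flip: power_mult)
    also have "\<dots> \<le> 8192 * real b ^ 9 + 1"
    proof -
      have "real b ^ 4 \<le> real b ^ 9" using b1' by (intro power_increasing) auto
      moreover have "real b ^ 4 \<ge> 0" by simp
      ultimately show ?thesis by linarith
    qed
    finally have "1 \<le> (8192 * real b ^ 9 + 1) / real d ^ 2"
      using d by (simp add: field_simps)
    then show ?thesis using lphs_trivial[OF n] unfolding b_def by blast
  next
    case False
    define T where "T = d div (4 * b ^ 2)"
    have T0: "T > 0" using False b1 by (simp add: T_def div_greater_zero_iff)
    have Td: "T * (4 * b ^ 2) \<le> d" unfolding T_def by (rule div_times_less_eq_dividend)
    have "b ^ 2 \<ge> 1" using b1 by simp
    then have "T * 4 \<le> d" using Td by (metis (no_types) dual_order.trans mult.right_neutral mult_le_mono2)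
    then have "(T * 4) ^ 2 \<le> d ^ 2" by (intro power_mono) auto
    then have T2: "4 * T ^ 2 \<le> n" using dn by (simp add: power_mult_distrib)
    have "real d < real ((T + 1) * (4 * b ^ 2))"
      unfolding T_def of_nat_less_iff using b1
      by (metis Suc_eq_plus1 dividend_less_div_times mult_Suc nat_0_less_mult_iff zero_less_numeral less_le_trans zero_less_one zero_less_power add.commute)
    also have "\<dots> \<le> real (2 * T * (4 * b ^ 2))"
      unfolding of_nat_le_iff using T0 by (intro mult_right_mono) auto
    finally have dT: "real d \<le> 8 * real b ^ 2 * real T" by (simp add: mult_ac)
    \<comment> \<open>The least such \<open>K\<close> is about \<open>log log T\<close>, so
      constants to the power \<open>K\<close> are polylogarithmic.\<close>
    define K where "K = (LEAST K. T \<le> 2 ^ 2 ^ K)"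
    have ex: "T \<le> 2 ^ 2 ^ T"
    proof -
      have "T \<le> 2 ^ T" using less_exp[of T] by (rule less_imp_le)
      also have "\<dots> \<le> 2 ^ 2 ^ T" using less_exp[of T] by (intro power_increasing less_imp_le) auto
      finally show ?thesis .
    qed
    have K: "T \<le> 2 ^ 2 ^ K" unfolding K_def by (rule LeastI[of _ T]) (rule ex)
    have Kmin: "2 ^ 2 ^ i < T" if "i < K" for i
      using not_less_Least[of i "\<lambda>K. T \<le> 2 ^ 2 ^ K"] that by (simp add: K_def not_le)
    have K2: "2 ^ K \<le> 2 * b"
    proof (cases K)
      case 0
      then show ?thesis using b1 by simp
    next
      case (Suc i)
      have "(2::nat) ^ 2 ^ i < T" using Kmin Suc by simp
      also have "T \<le> n" using T2 T0 by (auto simp: power2_eq_square intro: order.trans[of _ "T * T"])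
      also have "n \<le> 2 ^ b" by (rule nb)
      finally have "2 ^ i < b" by (simp add: power_strict_increasing_iff)
      then show ?thesis using Suc by simp
    qed
    have Kb: "K \<le> b"
    proof (cases K)
      case (Suc i)
      then have "2 ^ i \<le> b" using K2 by simp
      moreover have "i < 2 ^ i" by (rule less_exp)
      ultimately show ?thesis using Suc by linarith
    qed simp
    \<comment> \<open>This length gives \<open>2 ^ k \<ge> n ^ 4\<close>, so repeated windows cost
      at most \<open>1 / n\<^sup>2\<close>.\<close>
    define k where "k = 4 * b"
    have "b ^ 2 * 4 \<le> d" using False by simp
    then have "(b ^ 2 * 4) ^ 2 \<le> n" using dn by (meson order.trans power_mono zero_le)
    moreover have "2 * k \<le> (b ^ 2 * 4) ^ 2"
      using b1 power_increasing[of 1 4 b] by (simp add: k_def power_mult_distrib flip: power_mult)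
    ultimately have k: "2 * k \<le> n" by simp
    obtain h where h: "lphs n (K * (T * k)) (4 * 28 ^ K / real T ^ 2 + real n ^ 2 / 2 ^ k) (return_pmf h)"
      using exists_lphs_stages[OF n T2 k T0 Kmin K] by blast
    have "K * (T * k) \<le> b * (T * k)" using Kb by (rule mult_right_mono) simp
    also have "\<dots> \<le> d" using Td by (simp add: k_def power2_eq_square mult_ac)
    finally have q: "K * (T * k) \<le> d" .
    \<comment> \<open>Rounding up to a power of two expresses the bound through
      \<open>2 ^ K \<le> 2 * b\<close>.\<close>
    have "(28::real) ^ K \<le> 32 ^ K" by (intro power_mono) auto
    also have "(32::real) ^ K = (2 ^ 5) ^ K" by simp
    also have "\<dots> = (2 ^ K) ^ 5" by (simp only: power_mult[symmetric] mult.commute)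
    also have "\<dots> \<le> (2 * real b) ^ 5"
      using of_nat_mono[OF K2, where 'a = real] by (intro power_mono) auto
    also have "\<dots> = 32 * real b ^ 5" by (simp add: power_mult_distrib)
    finally have K28: "28 ^ K \<le> 32 * real b ^ 5" .
    have "real d ^ 2 \<le> (8 * real b ^ 2 * real T) ^ 2" using dT by (intro power_mono) auto
    also have "\<dots> = 64 * real b ^ 4 * real T ^ 2" by (simp add: power_mult_distrib flip: power_mult)
    finally have "4 * 28 ^ K * real d ^ 2 \<le> 4 * (32 * real b ^ 5) * (64 * real b ^ 4 * real T ^ 2)"
      using K28 by (intro mult_mono) auto
    also have "\<dots> = 8192 * real b ^ 9 * real T ^ 2" by (simp add: power_add[of _ 5 4, simplified])
    finally have e1: "4 * 28 ^ K / real T ^ 2 \<le> 8192 * real b ^ 9 / real d ^ 2"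
      using T0 d(1) by (simp add: field_simps)
    have "real n ^ 2 * real d ^ 2 \<le> real n ^ 2 * real n ^ 2"
    proof (intro mult_left_mono)
      have "real d ^ 2 \<le> real n" using of_nat_mono[OF dn, where 'a = real] by simp
      also have "\<dots> \<le> real n ^ 2" using n by (simp add: power2_eq_square)
      finally show "real d ^ 2 \<le> real n ^ 2" .
    qed simp
    also have "\<dots> = real n ^ 4" by (simp flip: power_add)
    also have "\<dots> \<le> (2 ^ b) ^ 4" using of_nat_mono[OF nb, where 'a = real] by (intro power_mono) auto
    also have "\<dots> = 2 ^ k" by (simp add: k_def mult.commute flip: power_mult)
    finally have e2: "real n ^ 2 / 2 ^ k \<le> 1 / real d ^ 2"
      using d(1) by (simp add: field_simps)
    have "4 * 28 ^ K / real T ^ 2 + real n ^ 2 / 2 ^ k \<le> (8192 * real b ^ 9 + 1) / real d ^ 2"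
      using e1 e2 by (simp add: add_divide_distrib)
    with h q show ?thesis unfolding b_def by (meson lphs_mono lphs_mono_error)
  qed
qed

section \<open>Walking until the walk is periodic\<close>

text \<open>The \<open>m\<close> jumps are shared by both walks, and the one behind always jumps.
  This keeps walks within distance \<open>L\<close> of each other once they are.\<close>

primrec meets :: "('w \<Rightarrow> nat) \<Rightarrow> (nat \<Rightarrow> 'w) \<Rightarrow> nat \<Rightarrow> nat \<Rightarrow> nat \<Rightarrow> bool" where
  "meets s w 0 a b \<longleftrightarrow> a = b"
| "meets s w (Suc m) a b \<longleftrightarrow> a = b \<or> a < b \<and> meets s w m (a + s (w a)) b \<or> b < a \<and> meets s w m a (b + s (w b))"

lemma meets_refl [simp]: "meets s w m a a"
  by (cases m) auto

lemma meets_sym: "meets s w m a b \<longleftrightarrow> meets s w m b a"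
  by (induction m arbitrary: a b) auto

lemma meetsD:
  "meets s w m a b \<Longrightarrow> \<exists>p q. p \<le> m \<and> q \<le> m \<and> ((\<lambda>i. i + s (w i)) ^^ p) a = ((\<lambda>i. i + s (w i)) ^^ q) b"
proof (induction m arbitrary: a b)
  case 0
  then show ?case by auto
next
  case (Suc m)
  let ?F = "\<lambda>i. i + s (w i)"
  from Suc.prems consider "a = b" | "meets s w m (?F a) b" | "meets s w m a (?F b)" by auto
  then show ?case
  proof cases
    case 1
    then show ?thesis by (intro exI[of _ 0]) auto
  next
    case 2
    from Suc.IH[OF this] obtain p q where "p \<le> m" "q \<le> m" "(?F ^^ p) (?F a) = (?F ^^ q) b" by blast
    then have "Suc p \<le> Suc m" "q \<le> Suc m" "(?F ^^ Suc p) a = (?F ^^ q) b"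
      by (simp_all only: funpow_Suc_right comp_apply)
    then show ?thesis by blast
  next
    case 3
    from Suc.IH[OF this] obtain p q where "p \<le> m" "q \<le> m" "(?F ^^ p) a = (?F ^^ q) (?F b)" by blast
    then have "p \<le> Suc m" "Suc q \<le> Suc m" "(?F ^^ p) a = (?F ^^ Suc q) b"
      by (simp_all only: funpow_Suc_right comp_apply)
    then show ?thesis by blast
  qed
qed

lemma meets_cong:
  assumes "\<And>i. i \<in> {min a b..<N} \<Longrightarrow> s' (w i) = s (w i)" "\<And>i. s (w i) \<le> L" "max a b + m * L \<le> N"
  shows "meets s' w m a b = meets s w m a b"
  using assms(1,3)
proof (induction m arbitrary: a b)
  case (Suc m)
  consider "a = b" | "a < b" | "b < a" by linarith
  then show ?case
  proof cases
    case 2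
    then have "s' (w a) = s (w a)" using Suc.prems by auto
    moreover have "meets s' w m (a + s (w a)) b = meets s w m (a + s (w a)) b"
    proof (rule Suc.IH)
      show "max (a + s (w a)) b + m * L \<le> N" using Suc.prems(2) assms(2)[of a] 2 by (auto simp: max_def)
    qed (use Suc.prems(1) 2 in auto)
    ultimately show ?thesis using 2 by simp
  next
    case 3
    then have "s' (w b) = s (w b)" using Suc.prems by auto
    moreover have "meets s' w m a (b + s (w b)) = meets s w m a (b + s (w b))"
    proof (rule Suc.IH)
      show "max a (b + s (w b)) + m * L \<le> N" using Suc.prems(2) assms(2)[of b] 3 by (auto simp: max_def)
    qed (use Suc.prems(1) 3 in auto)
    ultimately show ?thesis using 3 by simp
  qed simp
qed simp

text \<open>At distance at most \<open>L\<close>, exactly one of the \<open>L\<close> possible jumps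
  of the walk behind lands on the other walk, and any other jump leaves the distance at most
  \<open>L\<close>. Resampling makes the successive jumps independent.\<close>

lemma card_not_meets:
  fixes w :: "nat \<Rightarrow> 'w"
  assumes W: "finite W" "range w \<subseteq> W" and L: "L > 0"
    and "inj_on w {min a b..<N}" "max a b + m * L \<le> N" "max a b \<le> min a b + L"
  defines "\<S> \<equiv> W \<rightarrow>\<^sub>E {1..L}"
  shows "card {s \<in> \<S>. \<not> meets s w m a b} \<le> (1 - 1 / real L) ^ m * card \<S>"
proof -
  have fin: "finite \<S>" unfolding \<S>_def using W by (intro finite_PiE) auto
  have bound: "s (w i) \<le> L" if "s \<in> \<S>" for s i
    using that W by (auto simp: \<S>_def PiE_iff)
  have L1: "1 - 1 / real L \<ge> 0" using L by simp
  have eq: "real (card {s \<in> \<S>. \<not> meets s w m a b}) = (\<Sum>s\<in>\<S>. of_bool (\<not> meets s w m a b))" for m a b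
    using fin by (simp add: Int_def)
  let ?Q = "\<lambda>m a b. (\<Sum>s\<in>\<S>. of_bool (\<not> meets s w m a b)) \<le> (1 - 1 / real L) ^ m * card \<S>"
  have main: "?Q m a b" if "a \<le> b" "inj_on w {a..<N}" "b + m * L \<le> N" "b \<le> a + L" for m a b
    using that
  proof (induction m arbitrary: a b)
    case 0
    have "(\<Sum>s\<in>\<S>. of_bool (\<not> meets s w 0 a b)) \<le> (\<Sum>s\<in>\<S>. 1::real)" by (rule sum_mono) simp
    then show ?case by simp
  next
    case (Suc m)
    show ?case
    proof (cases "a = b")
      case True
      then show ?thesis using L1 by simp
    next
      case False
      with Suc.prems have ab: "a < b" by simp
      have wW: "w a \<in> W" using W by auto
      have "real L * (\<Sum>s\<in>\<S>. of_bool (\<not> meets s w (Suc m) a b))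
          = (\<Sum>v = 1..L. \<Sum>s\<in>\<S>. of_bool (\<not> meets (s(w a := v)) w (Suc m) a b))"
        using sum_PiE_resample[OF wW, where G = "\<lambda>s. of_bool (\<not> meets s w (Suc m) a b)" and S = "{1..L}"]
        by (simp add: \<S>_def)
      also have "\<dots> = (\<Sum>v = 1..L. \<Sum>s\<in>\<S>. of_bool (\<not> meets s w m (a + v) b))"
      proof (intro sum.cong refl)
        fix v s assume v: "v \<in> {1..L}" and s: "s \<in> \<S>"
        have "meets (s(w a := v)) w m (a + v) b = meets s w m (a + v) b"
        proof (rule meets_cong)
          fix i assume "i \<in> {min (a + v) b..<N}"
          then have "w i \<noteq> w a"
            using ab v Suc.prems by (auto dest!: inj_onD[of w _ i a])
          then show "(s(w a := v)) (w i) = s (w i)" by simp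
        next
          show "s (w i) \<le> L" for i using bound[OF s] .
          show "max (a + v) b + m * L \<le> N" using Suc.prems v ab by auto
        qed
        then show "of_bool (\<not> meets (s(w a := v)) w (Suc m) a b) = of_bool (\<not> meets s w m (a + v) b)"
          using ab by simp
      qed
      also have "\<dots> = (\<Sum>v\<in>{1..L} - {b - a}. \<Sum>s\<in>\<S>. of_bool (\<not> meets s w m (a + v) b))"
        using ab Suc.prems by (subst sum.remove[of _ "b - a"]) auto
      also have "\<dots> \<le> (\<Sum>v\<in>{1..L} - {b - a}. (1 - 1 / real L) ^ m * card \<S>)"
      proof (rule sum_mono)
        fix v assume v: "v \<in> {1..L} - {b - a}"
        show "?Q m (a + v) b"
        proof (cases "a + v \<le> b")
          case True
          then show ?thesis
            using v Suc.prems(3,4) by (intro Suc.IH inj_on_subset[OF Suc.prems(2)]) auto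
        next
          case False
          have "?Q m b (a + v)"
            using v Suc.prems(3,4) False ab by (intro Suc.IH inj_on_subset[OF Suc.prems(2)]) auto
          then show ?thesis by (simp add: meets_sym[of _ _ _ b])
        qed
      qed
      also have "\<dots> = (real L - 1) * ((1 - 1 / real L) ^ m * card \<S>)"
      proof -
        have "card ({1..L} - {b - a}) = L - 1"
          using ab Suc.prems(4) by (auto simp: card_Diff_singleton_if)
        then show ?thesis using L by (simp only: sum_constant) (simp add: of_nat_diff)
      qed
      also have "\<dots> = real L * ((1 - 1 / real L) ^ Suc m * card \<S>)"
        using L by (simp add: field_simps)
      finally show ?thesis using L by simp
    qed
  qed
  show ?thesis
  proof (cases "a \<le> b")
    case True
    then show ?thesis using main[of a b m] assms(4-6) by (simp add: eq)
  next
    case False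
    then have "?Q m b a" using assms(4-6) by (intro main) auto
    then show ?thesis by (simp add: eq meets_sym[of _ _ _ a])
  qed
qed

text \<open>A crude test of progress: a walk that is not slow has made one jump longer than
  \<open>L / 2\<close>, which suffices to advance that far.\<close>

primrec slow :: "('w \<Rightarrow> nat) \<Rightarrow> (nat \<Rightarrow> 'w) \<Rightarrow> nat \<Rightarrow> nat \<Rightarrow> nat \<Rightarrow> bool" where
  "slow s w L 0 a \<longleftrightarrow> True"
| "slow s w L (Suc m) a \<longleftrightarrow> 2 * s (w a) \<le> L \<and> slow s w L m (a + s (w a))"

lemma not_slow_progress:
  "\<not> slow s w L m a \<Longrightarrow> 2 * a + L \<le> 2 * ((\<lambda>i. i + s (w i)) ^^ m) a"
proof (induction m arbitrary: a)
  case (Suc m)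
  let ?F = "\<lambda>i. i + s (w i)"
  have mono: "b \<le> (?F ^^ j) b" for b j by (induction j) auto
  have "(?F ^^ Suc m) a = (?F ^^ m) (?F a)" by (simp only: funpow_Suc_right comp_apply)
  moreover have "2 * a + L \<le> 2 * (?F ^^ m) (?F a)"
  proof (cases "2 * s (w a) \<le> L")
    case True
    then have "\<not> slow s w L m (?F a)" using Suc.prems by simp
    from Suc.IH[OF this] show ?thesis by simp
  next
    case False
    then show ?thesis using mono[of "?F a" m] by linarith
  qed
  ultimately show ?case by metis
qed simp

lemma slow_cong:
  assumes "\<And>i. i \<in> {a..<N} \<Longrightarrow> s' (w i) = s (w i)" "\<And>i. s (w i) \<le> L" "L > 0" "a + m * L \<le> N"
  shows "slow s' w L m a = slow s w L m a"
  using assms(1,4)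
proof (induction m arbitrary: a)
  case (Suc m)
  have aL: "a + L + m * L \<le> N" using Suc.prems by simp
  then have "s' (w a) = s (w a)" using assms(3) by (intro Suc.prems) simp
  moreover have "slow s' w L m (a + s (w a)) = slow s w L m (a + s (w a))"
    using aL assms(2)[of a] Suc.prems(1) by (intro Suc.IH) auto
  ultimately show ?case by simp
qed simp

lemma card_slow:
  fixes w :: "nat \<Rightarrow> 'w"
  assumes W: "finite W" "range w \<subseteq> W" and L: "L > 0"
    and "inj_on w {a..<N}" "a + m * L \<le> N"
  defines "\<S> \<equiv> W \<rightarrow>\<^sub>E {1..L}"
  shows "card {s \<in> \<S>. slow s w L m a} \<le> (1 / 2) ^ m * card \<S>"
proof -
  have fin: "finite \<S>" unfolding \<S>_def using W by (intro finite_PiE) auto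
  have bound: "s (w i) \<le> L" if "s \<in> \<S>" for s i
    using that W by (auto simp: \<S>_def PiE_iff)
  have "(\<Sum>s\<in>\<S>. of_bool (slow s w L m a)) \<le> (1 / 2) ^ m * card \<S>"
    using assms(4,5)
  proof (induction m arbitrary: a)
    case 0
    then show ?case by simp
  next
    case (Suc m)
    have wW: "w a \<in> W" using W by auto
    have "real L * (\<Sum>s\<in>\<S>. of_bool (slow s w L (Suc m) a))
        = (\<Sum>v = 1..L. \<Sum>s\<in>\<S>. of_bool (slow (s(w a := v)) w L (Suc m) a))"
      using sum_PiE_resample[OF wW, where G = "\<lambda>s. of_bool (slow s w L (Suc m) a)" and S = "{1..L}"]
      by (simp add: \<S>_def)
    also have "\<dots> = (\<Sum>v = 1..L. of_bool (2 * v \<le> L) * (\<Sum>s\<in>\<S>. of_bool (slow s w L m (a + v))))"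
    proof (subst sum_distrib_left, intro sum.cong refl)
      fix v s assume v: "v \<in> {1..L}" and s: "s \<in> \<S>"
      have "slow (s(w a := v)) w L m (a + v) = slow s w L m (a + v)"
      proof (rule slow_cong)
        fix i assume "i \<in> {a + v..<N}"
        then have "w i \<noteq> w a"
          using v Suc.prems by (auto dest!: inj_onD[of w _ i a])
        then show "(s(w a := v)) (w i) = s (w i)" by simp
      next
        show "s (w i) \<le> L" for i using bound[OF s] .
        show "a + v + m * L \<le> N" using Suc.prems v by simp
      qed (rule L)
      then show "of_bool (slow (s(w a := v)) w L (Suc m) a) = of_bool (2 * v \<le> L) * (of_bool (slow s w L m (a + v)) :: real)"
        by simp
    qed
    also have "\<dots> \<le> (\<Sum>v = 1..L. of_bool (2 * v \<le> L) * ((1 / 2) ^ m * card \<S>))"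
    proof (intro sum_mono mult_left_mono)
      fix v assume v: "v \<in> {1..L}"
      show "(\<Sum>s\<in>\<S>. of_bool (slow s w L m (a + v))) \<le> (1 / 2) ^ m * card \<S>"
        using v Suc.prems by (intro Suc.IH) (auto intro: inj_on_subset)
    qed simp
    also have "\<dots> = real (card ({1..L} \<inter> {v. 2 * v \<le> L})) * ((1 / 2) ^ m * card \<S>)"
      by (simp flip: sum_distrib_right)
    also have "\<dots> \<le> (real L / 2) * ((1 / 2) ^ m * card \<S>)"
    proof (rule mult_right_mono)
      have "{1..L} \<inter> {v. 2 * v \<le> L} = {1..L div 2}" by auto
      then show "real (card ({1..L} \<inter> {v. 2 * v \<le> L})) \<le> real L / 2" by simp
    qed simp
    also have "\<dots> = real L * ((1 / 2) ^ Suc m * card \<S>)" by simp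
    finally show ?case using L by simp
  qed
  then show ?thesis using fin by (simp add: Int_def)
qed

section \<open>Deterministic walks with periodic step lengths\<close>

locale periodic_walk =
  fixes n :: nat and \<sigma> :: "nat \<Rightarrow> nat"
  assumes n: "n > 0" and period: "\<sigma> (i + n) = \<sigma> i" and step_pos: "\<sigma> i > 0"
begin

abbreviation pos :: "nat \<Rightarrow> nat \<Rightarrow> nat" where
  "pos m a \<equiv> ((\<lambda>i. i + \<sigma> i) ^^ m) a"

lemma period_mult: "\<sigma> (i + c * n) = \<sigma> i"
  by (induction c) (auto simp: period add.commute[of n] simp flip: add.assoc)

lemma pos_shift: "pos m (a + c * n) = pos m a + c * n"
  by (induction m) (auto simp: period_mult)

lemma pos_add: "pos (i + j) a = pos i (pos j a)"
  by (simp add: funpow_add)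

lemma pos_mono: "i \<le> j \<Longrightarrow> pos i a \<le> pos j a"
  by (rule lift_Suc_mono_le[of "\<lambda>m. pos m a"]) auto

text \<open>Periodicity extends \<open>fast\<close> to all starting points. Each block of
  \<open>l\<close> jumps then advances by at least \<open>L / 2\<close>, and \<open>M\<close> blocks
  make a full turn.\<close>

lemma lap:
  assumes L: "L > 0" and fast: "\<And>a. a < n \<Longrightarrow> 2 * a + L \<le> 2 * pos l a" and M: "2 * n \<le> M * L"
  shows "a + n \<le> pos (l * M) a"
proof -
  have fast': "2 * a + L \<le> 2 * pos l a" for a
  proof -
    have "pos l a = pos l (a mod n) + a div n * n"
      using pos_shift[of l "a mod n" "a div n"] by simp
    moreover have "a = a mod n + a div n * n" by simp
    moreover have "2 * (a mod n) + L \<le> 2 * pos l (a mod n)" using fast n by simp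
    ultimately show ?thesis by linarith
  qed
  have "2 * a + m * L \<le> 2 * pos (l * m) a" for m
  proof (induction m)
    case (Suc m)
    have "pos (l * Suc m) a = pos l (pos (l * m) a)" by (simp add: pos_add)
    then show ?case using Suc fast'[of "pos (l * m) a"] by simp
  qed simp
  from this[of M] M show ?thesis by linarith
qed

text \<open>After one turn the walk is at \<open>a + g + n\<close> with
  \<open>0 \<le> g \<le> L\<close>. From there it is the walk from \<open>a + g\<close> displaced by
  \<open>n\<close>, which meets the walk from \<open>a\<close>; so the walk meets its own displaced
  copy and repeats from then on.\<close>

lemma eventually_cyclic:
  assumes step_le: "\<And>i. \<sigma> i \<le> L" and lap: "a + n \<le> pos P a"
    and meet: "\<And>g. 0 < g \<Longrightarrow> g \<le> L \<Longrightarrow> \<exists>p q. p \<le> T \<and> q \<le> T \<and> pos p a = pos q (a + g)"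
  shows "\<exists>q r. q \<le> T \<and> 0 < r \<and> r \<le> T + P \<and> pos (r + q) a = pos q a + n"
proof -
  \<comment> \<open>Taking the first time past \<open>a + n\<close> limits the overshoot to one
    step.\<close>
  define p where "p = (LEAST p. a + n \<le> pos p a)"
  have p: "a + n \<le> pos p a" unfolding p_def by (rule LeastI[of _ P]) (rule lap)
  have pP: "p \<le> P" unfolding p_def by (rule Least_le) (rule lap)
  have p0: "p > 0" using p n by (cases p) auto
  then obtain p' where p': "p = Suc p'" by (cases p) auto
  have "pos p' a < a + n"
    using not_less_Least[of p' "\<lambda>p. a + n \<le> pos p a"] p' by (simp add: p_def)
  then have less: "pos p a < a + n + L"
    using step_le[of "pos p' a"] by (simp add: p')
  define g where "g = pos p a - (a + n)"
  have g: "pos p a = (a + g) + 1 * n" "g \<le> L" using p less by (auto simp: g_def)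
  show ?thesis
  proof (cases "g = 0")
    case True
    then show ?thesis using g p0 pP by (intro exI[of _ 0] exI[of _ p]) auto
  next
    case False
    then obtain q q' where q: "q \<le> T" "q' \<le> T" "pos q a = pos q' (a + g)"
      using meet[of g] g(2) by auto
    have "pos (q' + p) a = pos q' (pos p a)" by (rule pos_add)
    also have "\<dots> = pos q' (a + g + 1 * n)" by (simp only: g(1))
    also have "\<dots> = pos q' (a + g) + 1 * n" by (rule pos_shift)
    finally have eq: "pos (q' + p) a = pos q a + n" using q(3) by simp
    have "q < q' + p"
    proof (rule ccontr)
      assume "\<not> q < q' + p"
      then have "pos (q' + p) a \<le> pos q a" by (intro pos_mono) simp
      with eq n show False by simp
    qed
    with eq q pP show ?thesis
      by (intro exI[of _ q] exI[of _ "q' + p - q"]) auto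
  qed
qed

lemma pos_periodic:
  assumes "pos (r + q) a = pos q a + n" "q \<le> m"
  shows "pos (m + c * r) a = pos m a + c * n"
proof (induction c)
  case (Suc c)
  have "pos (m + Suc c * r) a = pos ((m + c * r - q) + (r + q)) a"
    using assms(2) by (intro arg_cong[where f = "\<lambda>m. pos m a"]) simp
  also have "\<dots> = pos (m + c * r - q) (pos (r + q) a)" by (rule pos_add)
  also have "\<dots> = pos (m + c * r - q) (pos q a + 1 * n)" by (simp only: assms(1) mult_1)
  also have "\<dots> = pos (m + c * r - q) (pos q a) + 1 * n" by (rule pos_shift)
  also have "pos (m + c * r - q) (pos q a) = pos (m + c * r) a"
    using assms(2) by (simp flip: pos_add)
  finally show ?case using Suc by simp
qed simp

text \<open>Every place on the cycle reached from \<open>b\<close> is also reached from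
  \<open>a\<close>, within one period after time \<open>T\<close>. The walk from \<open>b\<close> is
  followed past the meeting point, continued as the walk from \<open>a\<close>, and the time is
  reduced modulo the period \<open>r\<close>.\<close>

lemma reach_mod:
  assumes a: "q \<le> T" "0 < r" "r \<le> W" "pos (r + q) a = pos q a + n"
    and b: "q' \<le> T" "0 < r'" "pos (r' + q') b = pos q' b + n"
    and meet: "P1 \<le> T" "pos P1 b = pos P2 a" and i: "T \<le> i"
  shows "\<exists>j\<in>{T..<T + W}. pos j a mod n = pos i b mod n"
proof -
  \<comment> \<open>Going \<open>T\<close> more times around leaves the residue unchanged and makes
    the time exceed both \<open>P1\<close> and, after its subtraction, \<open>T\<close>.\<close>
  define i' where "i' = i + T * r'"
  define m where "m = i' - P1 + P2"
  define j where "j = T + (m - T) mod r"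
  have "T \<le> T * r'" using b(2) by simp
  then have m: "T \<le> m" "P1 \<le> i'" using i meet(1) unfolding m_def i'_def by linarith+
  have "pos i' b mod n = pos i b mod n"
    using pos_periodic[OF b(3), of i T] b(1) i by (simp add: i'_def)
  moreover have "pos i' b = pos m a"
  proof -
    have "pos i' b = pos ((i' - P1) + P1) b" using m(2) by simp
    also have "\<dots> = pos (i' - P1) (pos P2 a)" by (simp only: pos_add meet(2))
    finally show ?thesis by (simp only: m_def pos_add)
  qed
  moreover have "pos m a mod n = pos j a mod n"
  proof -
    have "m = j + (m - T) div r * r" using m by (simp add: j_def)
    then have "pos m a = pos (j + (m - T) div r * r) a" by (rule arg_cong)
    also have "\<dots> = pos j a + (m - T) div r * n"
      by (rule pos_periodic[OF a(4)]) (use a(1) in \<open>simp add: j_def\<close>)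
    finally show ?thesis by simp
  qed
  moreover have "j \<in> {T..<T + W}"
    using a(2,3) mod_less_divisor[OF a(2), of "m - T"] by (auto simp: j_def intro: less_le_trans)
  ultimately show ?thesis by auto
qed

end

lemma one_minus_inverse_power_le:
  assumes "L > 0"
  shows "(1 - 1 / real L) ^ (L * l) \<le> (1 / 2) ^ l"
proof -
  have "(1 - 1 / real L) ^ L \<le> exp (- 1 / real L) ^ L"
    using assms exp_ge_add_one_self[of "- 1 / real L"] by (intro power_mono) auto
  also have "\<dots> = exp (- 1)"
    using assms by (simp flip: exp_of_nat_mult)
  also have "\<dots> \<le> 1 / 2"
    using exp_ge_add_one_self[of 1] by (simp add: exp_minus field_simps)
  finally have "((1 - 1 / real L) ^ L) ^ l \<le> (1 / 2) ^ l"
    using assms by (intro power_mono) auto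
  then show ?thesis by (simp add: power_mult)
qed

text \<open>There are \<open>2 * L\<close> merging events and \<open>n\<close> progress events, each
  failing with probability at most \<open>1 / 2 ^ l\<close>. If none fails, the walks from 0 and 1
  share a cycle that each covers entirely at the times from \<open>T\<close> to
  \<open>T + W - 1\<close>. Both then minimise the fixed order \<open>e\<close> over the same
  windows.\<close>

lemma exists_cycle_hash:
  assumes n: "n > 1" "2 * k \<le> n" and L: "L > 0" "L + L * l * L \<le> n" and l: "l > 0" and M: "2 * n \<le> M * L"
  shows "\<exists>h. lphs n ((2 * (L * l) + l * M) * k)
    ((2 * real L + real n) / 2 ^ l + real n ^ 2 / 2 ^ k) (return_pmf h)"
proof -
  have n0: "n > 0" using n by simp
  define T where "T = L * l"
  have T: "T > 0" "L + T * L \<le> n" using L l by (auto simp: T_def)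
  define W where "W = T + l * M"
  define e where "e = (to_nat :: bool list \<Rightarrow> nat)"
  define \<S> where "\<S> = bitstrings k \<rightarrow>\<^sub>E {1..L}"
  have finS: "finite \<S>" unfolding \<S>_def by (intro finite_PiE) auto
  have neS: "\<S> \<noteq> {}" unfolding \<S>_def using L by (auto simp: PiE_eq_empty_iff)
  define bad where "bad = (\<lambda>s x. (\<exists>a\<in>{0, 1}. \<exists>g\<in>{1..L}. \<not> meets s (window n k x) T a (a + g))
    \<or> (\<exists>a<n. slow s (window n k x) L l a))"
  let ?c = "(2 * real L + real n) / 2 ^ l"
  have "\<exists>s\<in>\<S>. 1 * real (card {x \<in> distinct_windows n k. bad s x}) \<le> ?c * card (distinct_windows n k)"
  proof (rule averaging[OF finS neS])
    fix x assume x: "x \<in> distinct_windows n k"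
    let ?w = "window n k x"
    have rw: "range ?w \<subseteq> bitstrings k" by auto
    have "{s \<in> \<S>. bad s x} \<subseteq> (\<Union>(a, g)\<in>{0, 1} \<times> {1..L}. {s \<in> \<S>. \<not> meets s ?w T a (a + g)})
        \<union> (\<Union>a\<in>{..<n}. {s \<in> \<S>. slow s ?w L l a})"
      by (auto simp: bad_def)
    then have "card {s \<in> \<S>. bad s x} \<le> card ((\<Union>(a, g)\<in>{0, 1} \<times> {1..L}. {s \<in> \<S>. \<not> meets s ?w T a (a + g)})
        \<union> (\<Union>a\<in>{..<n}. {s \<in> \<S>. slow s ?w L l a}))"
      by (rule card_mono[rotated]) (use finS in auto)
    also have "\<dots> \<le> card (\<Union>(a, g)\<in>{0, 1} \<times> {1..L}. {s \<in> \<S>. \<not> meets s ?w T a (a + g)})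
        + card (\<Union>a\<in>{..<n}. {s \<in> \<S>. slow s ?w L l a})"
      by (rule card_Un_le)
    also have "\<dots> \<le> (\<Sum>(a, g)\<in>{0, 1} \<times> {1..L}. card {s \<in> \<S>. \<not> meets s ?w T a (a + g)})
        + (\<Sum>a<n. card {s \<in> \<S>. slow s ?w L l a})"
      unfolding case_prod_unfold by (intro add_mono card_UN_le) auto
    finally have "real (card {s \<in> \<S>. bad s x}) \<le> real ((\<Sum>(a, g)\<in>{0, 1} \<times> {1..L}. card {s \<in> \<S>. \<not> meets s ?w T a (a + g)})
        + (\<Sum>a<n. card {s \<in> \<S>. slow s ?w L l a}))"
      by (rule of_nat_mono)
    also have "\<dots> = (\<Sum>(a, g)\<in>{0, 1} \<times> {1..L}. real (card {s \<in> \<S>. \<not> meets s ?w T a (a + g)}))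
        + (\<Sum>a<n. real (card {s \<in> \<S>. slow s ?w L l a}))"
      by (simp add: case_prod_unfold)
    also have "\<dots> \<le> (\<Sum>(a, g)\<in>{0, 1 :: nat} \<times> {1..L}. (1 / 2) ^ l * card \<S>) + (\<Sum>a<n. (1 / 2) ^ l * card \<S>)"
    proof (intro add_mono sum_mono)
      fix z assume z: "z \<in> {0, 1 :: nat} \<times> {1..L}"
      obtain a g where ag: "z = (a, g)" "g \<in> {1..L}" using z by auto
      have "real (card {s \<in> \<S>. \<not> meets s ?w T a (a + g)}) \<le> (1 - 1 / real L) ^ T * card \<S>"
        unfolding \<S>_def
        by (rule card_not_meets[where N = "a + n"])
           (use ag T rw L(1) inj_on_window[OF x, of a] in auto)
      also have "\<dots> \<le> (1 / 2) ^ l * card \<S>"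
        unfolding T_def using one_minus_inverse_power_le[OF L(1), of l] by (rule mult_right_mono) simp
      finally show "(case z of (a, g) \<Rightarrow> real (card {s \<in> \<S>. \<not> meets s ?w T a (a + g)})) \<le> (case z of (a, g) \<Rightarrow> (1 / 2) ^ l * card \<S>)"
        by (simp add: ag)
    next
      fix a
      have "l * L \<le> T * L" using L(1) by (intro mult_right_mono) (auto simp: T_def)
      then have "a + l * L \<le> a + n" using T(2) by linarith
      then show "real (card {s \<in> \<S>. slow s ?w L l a}) \<le> (1 / 2) ^ l * card \<S>"
        unfolding \<S>_def by (intro card_slow[where N = "a + n"] inj_on_window[OF x] rw L(1)) auto
    qed
    also have "\<dots> = ?c * card \<S>"
      by (simp add: card_cartesian_product power_divide field_simps)
    finally show "1 * real (card {s \<in> \<S>. bad s x}) \<le> ?c * card \<S>" by simp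
  qed simp
  then obtain s where s: "s \<in> \<S>"
    and c: "real (card {x \<in> distinct_windows n k. bad s x}) \<le> ?c * card (distinct_windows n k)"
    by auto
  define g where "g = (\<lambda>x a. stage n k s e T (T + W) x a)"
  have good: "g x 0 mod n = g x 1 mod n" if x: "x \<in> distinct_windows n k" and nb: "\<not> bad s x" for x
  proof -
    let ?w = "window n k x"
    have s1: "s (?w i) \<le> L" "s (?w i) > 0" for i
      using PiE_mem[OF s[unfolded \<S>_def], of "?w i"] by auto
    have per: "?w (i + n) = ?w i" for i
      using window_mod[of n k x "i + n"] window_mod[of n k x i] by simp
    interpret periodic_walk n "\<lambda>i. s (?w i)"
      by unfold_locales (use n s1 in \<open>auto simp: per\<close>)
    have fast: "2 * a + L \<le> 2 * pos l a" if "a < n" for a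
      using not_slow_progress[of s ?w L l a] nb that by (auto simp: bad_def)
    have lap: "a + n \<le> pos (l * M) a" for a
      by (rule lap[OF L(1) fast M])
    have cyc: "\<exists>q r. q \<le> T \<and> 0 < r \<and> r \<le> W \<and> pos (r + q) a = pos q a + n" if "a \<in> {0, 1}" for a
      unfolding W_def
    proof (rule eventually_cyclic[OF s1(1) lap])
      fix g assume "0 < g" "g \<le> L"
      then have "meets s ?w T a (a + g)" using nb that by (auto simp: bad_def)
      then show "\<exists>p q. p \<le> T \<and> q \<le> T \<and> pos p a = pos q (a + g)" by (rule meetsD)
    qed
    obtain q r where q: "q \<le> T" "0 < r" "r \<le> W" "pos (r + q) 0 = pos q 0 + n" using cyc[of 0] by auto
    obtain q' r' where q': "q' \<le> T" "0 < r'" "r' \<le> W" "pos (r' + q') 1 = pos q' 1 + n" using cyc[of 1] by auto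
    \<comment> \<open>The case \<open>g = 1\<close> of the merging events joins the two starting
      points themselves.\<close>
    have "meets s ?w T 0 (0 + 1)" using nb L(1) by (auto simp: bad_def)
    from meetsD[OF this] obtain P1 P2 where P: "P1 \<le> T" "P2 \<le> T" "pos P1 0 = pos P2 1" by auto
    have TW: "T < T + W" using T(1) by (simp add: W_def)
    obtain i where i: "i \<in> {T..<T + W}" "g x 0 = pos i 0"
      and imin: "\<And>i'. i' \<in> {T..<T + W} \<Longrightarrow> e (?w (pos i 0)) \<le> e (?w (pos i' 0))"
      unfolding g_def by (rule stage_minimal[OF TW, of n k s e x 0]) blast
    obtain j where j: "j \<in> {T..<T + W}" "g x 1 = pos j 1"
      and jmin: "\<And>j'. j' \<in> {T..<T + W} \<Longrightarrow> e (?w (pos j 1)) \<le> e (?w (pos j' 1))"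
      unfolding g_def by (rule stage_minimal[OF TW, of n k s e x 1]) blast
    have w_eq: "?w u = ?w v \<longleftrightarrow> u mod n = v mod n" for u v
      by (rule window_eq_iff[OF x n0])
    obtain j' where "j' \<in> {T..<T + W}" "pos j' 1 mod n = pos i 0 mod n"
      using reach_mod[OF q' q(1,2,4) P(1,3), of i] i(1) by auto
    then have "e (?w (pos j 1)) \<le> e (?w (pos i 0))" using jmin[of j'] w_eq by metis
    moreover obtain i' where "i' \<in> {T..<T + W}" "pos i' 0 mod n = pos j 1 mod n"
      using reach_mod[OF q q'(1,2,4) P(2) P(3)[symmetric], of j] j(1) by auto
    then have "e (?w (pos i 0)) \<le> e (?w (pos j 1))" using imin[of i'] w_eq by metis
    ultimately have "?w (pos i 0) = ?w (pos j 1)" by (simp add: e_def)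
    then show ?thesis using w_eq i(2) j(2) by simp
  qed
  have "real (card {x \<in> distinct_windows n k. g x 0 mod n \<noteq> g x 1 mod n}) \<le> card {x \<in> distinct_windows n k. bad s x}"
    using good by (intro of_nat_mono card_mono) auto
  also have "\<dots> \<le> ?c * card (distinct_windows n k)" by (rule c)
  also have "\<dots> \<le> ?c * 2 ^ n"
  proof (rule mult_left_mono)
    have "card (distinct_windows n k) \<le> card (bitstrings n)"
      by (intro card_mono) (auto simp: distinct_windows_def)
    then show "real (card (distinct_windows n k)) \<le> 2 ^ n" by (simp flip: of_nat_le_iff)
  qed simp
  finally have D: "card {x \<in> distinct_windows n k. g x 0 mod n \<noteq> g x 1 mod n} \<le> ?c * 2 ^ n" .
  have "shift_equivariant n g"
    using n0 by (simp add: shift_equivariant_def g_def stage_rotate1)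
  from card_errors_le[OF this n(2) n0 D]
  have "lphs n ((T + W) * k) (?c + real n ^ 2 / 2 ^ k) (return_pmf (\<lambda>x. g x 0 mod n))"
    unfolding lphs_return_pmf g_def
    using n0 query_computable_map[OF query_computable_stage[OF n0]] by auto
  moreover have "T + W = 2 * (L * l) + l * M" by (simp add: T_def W_def)
  ultimately show ?thesis by auto
qed

text \<open>With \<open>L\<close> about the square root of \<open>n\<close> over
  \<open>2 * b\<close> and \<open>l = k = b\<^sup>2\<close>, merging fits into one turn, and
  \<open>big\<close> ensures \<open>L \<ge> 1\<close>. A turn takes \<open>l * M\<close> jumps with
  \<open>M \<le> 9 * b * R\<close>, which gives the query bound. The error is at most
  \<open>n ^ 3 / 2 ^ b\<^sup>2\<close>, and \<open>2 ^ b\<^sup>2 \<ge> n ^ b\<close> because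
  \<open>2 ^ b \<ge> n\<close>.\<close>

lemma exists_lphs_superpoly:
  assumes n: "n > 0" and big: "4 * logsize n ^ 2 \<le> n"
  shows "\<exists>h. lphs n (nat \<lfloor>10 * real (logsize n) ^ 5 * sqrt (real n)\<rfloor>) (real n powr (3 - real (logsize n))) (return_pmf h)"
proof -
  define b where "b = logsize n"
  have b1: "b \<ge> 1" unfolding b_def by (simp add: Suc_leI)
  have b1': "real b \<ge> 1" using b1 by simp
  have nb: "n \<le> 2 ^ b" unfolding b_def by (rule le_two_power_logsize)
  have bn: "4 * b ^ 2 \<le> n" using big by (simp add: b_def)
  have bn': "4 * real b ^ 2 \<le> real n" using of_nat_mono[OF bn, where 'a = real] by simp
  have "1 \<le> b ^ 2" using b1 by simp
  with bn have n4: "n \<ge> 4" by linarith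
  define R where "R = sqrt (real n)"
  have R2: "R ^ 2 = real n" by (simp add: R_def)
  have Rb: "2 * real b \<le> R"
    unfolding R_def using bn' by (intro real_le_rsqrt) (simp add: power_mult_distrib)
  define L where "L = nat \<lfloor>R / (2 * real b)\<rfloor>"
  have "R / (2 * real b) \<ge> 1" using Rb b1' by (simp add: le_divide_eq)
  then have "\<lfloor>R / (2 * real b)\<rfloor> \<ge> 1" by simp
  then have "L > 0" and "real L = of_int \<lfloor>R / (2 * real b)\<rfloor>" and "real L \<ge> 1"
    by (simp_all add: L_def)
  then have L: "L > 0" "real L \<le> R / (2 * real b)" "R / (2 * real b) \<le> 2 * real L"
    by linarith+
  have LR: "real L * (2 * real b) \<le> R" "R \<le> real L * (4 * real b)"
    using L(2,3) b1' by (auto simp: field_simps)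
  have "real L * (2 * real b) * (real L * (2 * real b)) \<le> R * R"
    using LR(1) b1' by (intro mult_mono) (auto simp: R_def)
  then have LL: "4 * (real L * real b ^ 2 * real L) \<le> real n"
    using R2 by (simp add: power2_eq_square mult_ac)
  have L2: "2 * real L \<le> real n"
  proof -
    have "real L * 2 \<le> real L * (2 * real b)" using b1' by (intro mult_left_mono) auto
    also have "\<dots> \<le> R" by (rule LR)
    also have "\<dots> \<le> R ^ 2" using Rb b1' by (intro self_le_power) auto
    finally show ?thesis using R2 by simp
  qed
  have "real (L + L * b ^ 2 * L) \<le> real n"
    using LL L2 by simp
  then have Ln: "L + L * b ^ 2 * L \<le> n" by (simp only: of_nat_le_iff)
  define M where "M = 2 * n div L + 1"
  have M: "2 * n \<le> M * L"
    unfolding M_def using L(1) by (metis Suc_eq_plus1 dividend_less_div_times less_imp_le mult_Suc add.commute)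
  have k: "2 * b ^ 2 \<le> n" using bn by simp
  obtain h where h: "lphs n ((2 * (L * b ^ 2) + b ^ 2 * M) * b ^ 2)
      ((2 * real L + real n) / 2 ^ b ^ 2 + real n ^ 2 / 2 ^ b ^ 2) (return_pmf h)"
    using exists_cycle_hash[of n "b ^ 2" L "b ^ 2" M] n4 k L(1) Ln b1 M by auto
  have "real M \<le> real (2 * n) / real L + 1"
    unfolding M_def using of_nat_div_le_of_nat[of "2 * n" L, where 'a = real] by simp
  also have "\<dots> \<le> 8 * real b * R + 1"
  proof -
    have "2 * real n = 2 * R * R" using R2 by (simp add: power2_eq_square)
    also have "\<dots> \<le> 2 * R * (real L * (4 * real b))" using LR(2) by (intro mult_left_mono) (auto simp: R_def)
    finally show ?thesis using L(1) by (simp add: field_simps)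
  qed
  also have "\<dots> \<le> 9 * real b * R"
  proof -
    have "1 * 1 \<le> real b * R" using b1' Rb by (intro mult_mono) auto
    then show ?thesis by (simp add: mult_ac)
  qed
  finally have MR: "real M \<le> 9 * real b * R" .
  have "2 * real L \<le> real b * R"
  proof -
    have "2 * real L * 1 \<le> 2 * real L * real b" using b1' by (intro mult_left_mono) auto
    also have "\<dots> \<le> R" using LR(1) by simp
    also have "\<dots> \<le> real b * R" using b1' by (simp add: R_def mult_le_cancel_right1)
    finally show ?thesis by simp
  qed
  then have "2 * real L + real M \<le> 10 * (real b * R)" using MR by simp
  then have "real b ^ 4 * (2 * real L + real M) \<le> real b ^ 4 * (10 * (real b * R))"
    by (intro mult_left_mono) auto
  then have "real ((2 * (L * b ^ 2) + b ^ 2 * M) * b ^ 2) \<le> 10 * real b ^ 5 * R"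
    by (simp add: power4_eq_xxxx power2_eq_square eval_nat_numeral algebra_simps)
  then have q: "(2 * (L * b ^ 2) + b ^ 2 * M) * b ^ 2 \<le> nat \<lfloor>10 * real b ^ 5 * R\<rfloor>"
    by (simp add: le_nat_floor)
  have "real n ^ b \<le> (2 ^ b) ^ b" using of_nat_mono[OF nb, where 'a = real] by (intro power_mono) auto
  then have nbb: "real n ^ b \<le> 2 ^ b ^ 2" by (simp add: power2_eq_square power_mult)
  have "(2 * real L + real n) / 2 ^ b ^ 2 + real n ^ 2 / 2 ^ b ^ 2 = (2 * real L + real n + real n ^ 2) / 2 ^ b ^ 2"
    by (simp add: add_divide_distrib)
  also have "\<dots> \<le> real n ^ 3 / 2 ^ b ^ 2"
  proof (rule divide_right_mono)
    have "4 * real n \<le> real n * real n" using n4 by (intro mult_right_mono) auto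
    moreover have "4 * (real n * real n) \<le> real n * (real n * real n)" using n4 by (intro mult_right_mono) auto
    ultimately show "2 * real L + real n + real n ^ 2 \<le> real n ^ 3"
      using L2 by (simp add: power2_eq_square power3_eq_cube)
  qed simp
  also have "\<dots> \<le> real n ^ 3 / real n ^ b"
    using nbb n by (intro divide_left_mono) auto
  also have "\<dots> = real n powr (3 - real b)"
    using n by (simp add: powr_diff powr_realpow)
  finally show ?thesis
    using h q unfolding b_def R_def by (meson lphs_mono lphs_mono_error)
qed

section \<open>Asymptotics\<close>

lemma logsize_bigo: "(\<lambda>n. real (logsize n)) \<in> O(\<lambda>n. ln (real n))"
proof (rule bigoI)
  \<comment> \<open>The ceiling and the added 1 contribute at most 2, which is absorbed into the
    logarithm.\<close>
  have "\<forall>\<^sub>F n in sequentially. 2 \<le> ln (real n)"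
    by (intro eventually_compose_filterlim[OF _ filterlim_real_sequentially]
      eventually_at_top_linorderI[of "exp 2"]) (simp add: ln_ge_iff[OF less_le_trans[OF exp_gt_zero]])
  then show "\<forall>\<^sub>F n in sequentially. norm (real (logsize n)) \<le> (1 / ln 2 + 1) * norm (ln (real n))"
  proof eventually_elim
    case (elim n)
    then have "log 2 (real n) \<ge> 0" by (simp add: log_def)
    then have "real (logsize n) \<le> log 2 (real n) + 2"
      unfolding logsize_def by linarith
    also have "\<dots> \<le> ln (real n) / ln 2 + ln (real n)"
      using elim by (simp add: log_def)
    finally show ?case using elim by (simp add: algebra_simps)
  qed
qed

lemma polylog_logsize:
  assumes "c \<ge> 0"
  shows "polylog (\<lambda>n. c * real (logsize n) ^ k + c')"
  unfolding polylog_def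
proof (rule exI[of _ k])
  have "(\<lambda>n. real (logsize n) ^ k) \<in> O(\<lambda>n. ln (real n) ^ k)"
    by (rule landau_o.big_power[OF logsize_bigo])
  then have "(\<lambda>n. c * real (logsize n) ^ k) \<in> O(\<lambda>n. ln (real n) ^ k)"
    by simp
  moreover have "(\<lambda>n. c') \<in> O(\<lambda>n. ln (real n) ^ k)"
  proof (rule bigoI)
    have "\<forall>\<^sub>F n in sequentially. 1 \<le> ln (real n)"
      by (intro eventually_compose_filterlim[OF _ filterlim_real_sequentially]
        eventually_at_top_linorderI[of "exp 1"]) (simp add: ln_ge_iff[OF less_le_trans[OF exp_gt_zero]])
    then show "\<forall>\<^sub>F n in sequentially. norm c' \<le> \<bar>c'\<bar> * norm (ln (real n) ^ k)"
    proof eventually_elim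
      case (elim n)
      then have "1 \<le> ln (real n) ^ k" by (rule one_le_power)
      then have "\<bar>c'\<bar> * 1 \<le> \<bar>c'\<bar> * \<bar>ln (real n) ^ k\<bar>" by (intro mult_left_mono) auto
      then show ?case by simp
    qed
  qed
  ultimately show "(\<lambda>n. c * real (logsize n) ^ k + c') \<in> O(\<lambda>n. ln (real n) ^ k)"
    by (rule sum_in_bigo)
qed

lemma filterlim_logsize: "filterlim (\<lambda>n. real (logsize n)) at_top sequentially"
proof (rule filterlim_at_top_mono)
  show "filterlim (\<lambda>n. log 2 (real n)) at_top sequentially"
    by real_asymp
  show "\<forall>\<^sub>F n in sequentially. log 2 (real n) \<le> real (logsize n)"
    unfolding logsize_def by (intro always_eventually allI) linarith
qed

lemma eventually_logsize_small: "\<forall>\<^sub>F n in sequentially. 4 * logsize n ^ 2 \<le> n"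
proof -
  have "\<forall>\<^sub>F n in sequentially. 4 * (log 2 (real n) + 2) ^ 2 \<le> real n"
    by real_asymp
  then show ?thesis
    using eventually_gt_at_top[of 0]
  proof eventually_elim
    case (elim n)
    then have "log 2 (real n) \<ge> 0" by simp
    then have "real (logsize n) \<le> log 2 (real n) + 2"
      unfolding logsize_def by linarith
    then have "real (logsize n) ^ 2 \<le> (log 2 (real n) + 2) ^ 2" by (intro power_mono) auto
    with elim(1) have "4 * real (logsize n) ^ 2 \<le> real n" by linarith
    then have "real (4 * logsize n ^ 2) \<le> real n" by simp
    then show ?case by (simp only: of_nat_le_iff)
  qed
qed

text \<open>Both constructions are deterministic, while the lower bounds hold for every distribution
  \<open>H\<close>. Optimality of the error starts at \<open>n = 2\<close>, since for
  \<open>n = 1\<close> a constant hash never errs.\<close>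

theorem theorem1:
  "(\<exists>p. polylog p \<and>
      (\<forall>n>0. \<forall>d>0. real d \<le> sqrt (real n) \<longrightarrow>
         (\<exists>h. lphs n d (p n / real d ^ 2) (return_pmf h))))
   \<and> (\<exists>p d \<delta>. polylog p \<and> superpoly_small \<delta> \<and>
      (\<forall>n>0. real (d n) \<le> p n * sqrt (real n) \<and>
         (\<exists>h. lphs n (d n) (\<delta> n) (return_pmf h))))
   \<and> (\<exists>p. polylog p \<and>
      (\<forall>n\<ge>2. \<forall>d>0. real d \<le> sqrt (real n) \<longrightarrow>
         (\<forall>\<delta> H. lphs n d \<delta> H \<longrightarrow> 1 / real d ^ 2 \<le> p n * \<delta>)))
   \<and> (\<forall>d \<delta> H. superpoly_small \<delta> \<and> (\<forall>n>0. lphs n (d n) (\<delta> n) (H n)) \<longrightarrow>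
      (\<exists>p. polylog p \<and>
         (\<forall>\<^sub>F n in sequentially. sqrt (real n) \<le> p n * real (d n))))"
proof (intro conjI)
  show "\<exists>p. polylog p \<and>
      (\<forall>n>0. \<forall>d>0. real d \<le> sqrt (real n) \<longrightarrow>
         (\<exists>h. lphs n d (p n / real d ^ 2) (return_pmf h)))"
    using exists_lphs_inverse_square
    by (intro exI[of _ "\<lambda>n. 8192 * real (logsize n) ^ 9 + 1"] conjI polylog_logsize) auto
next
  let ?p = "\<lambda>n. 10 * real (logsize n) ^ 5 + 0"
  let ?d = "\<lambda>n. nat \<lfloor>10 * real (logsize n) ^ 5 * sqrt (real n)\<rfloor>"
  \<comment> \<open>For the finitely many small \<open>n\<close> the error bound is 1, which the
    constant hash satisfies.\<close>
  let ?\<delta> = "\<lambda>n. if 4 * logsize n ^ 2 \<le> n then real n powr (3 - real (logsize n)) else 1"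
  have "superpoly_small ?\<delta>"
    unfolding superpoly_small_def
  proof (intro exI[of _ "\<lambda>n. real (logsize n) - 3"] conjI)
    show "filterlim (\<lambda>n. real (logsize n) - 3) at_top sequentially"
      using filterlim_tendsto_add_at_top[OF tendsto_const[of "-3"] filterlim_logsize] by simp
    show "\<forall>\<^sub>F n in sequentially. ?\<delta> n \<le> real n powr - (real (logsize n) - 3)"
      using eventually_logsize_small by eventually_elim simp
  qed
  moreover have "real (?d n) \<le> ?p n * sqrt (real n)" for n
    using of_nat_floor[of "10 * real (logsize n) ^ 5 * sqrt (real n)"] by simp
  moreover have "\<exists>h. lphs n (?d n) (?\<delta> n) (return_pmf h)" if "n > 0" for n
    using exists_lphs_superpoly[OF that] lphs_trivial[OF that] by auto
  ultimately show "\<exists>p d \<delta>. polylog p \<and> superpoly_small \<delta> \<and>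
      (\<forall>n>0. real (d n) \<le> p n * sqrt (real n) \<and>
         (\<exists>h. lphs n (d n) (\<delta> n) (return_pmf h)))"
    by (intro exI[of _ ?p] exI[of _ ?d] exI[of _ ?\<delta>] conjI polylog_logsize allI impI) simp_all
next
  show "\<exists>p. polylog p \<and>
      (\<forall>n\<ge>2. \<forall>d>0. real d \<le> sqrt (real n) \<longrightarrow>
         (\<forall>\<delta> H. lphs n d \<delta> H \<longrightarrow> 1 / real d ^ 2 \<le> p n * \<delta>))"
    using lphs_error_ge polylog_logsize[of 0 0 18] by (intro exI[of _ "\<lambda>n. 18"]) auto
next
  show "\<forall>d \<delta> H. superpoly_small \<delta> \<and> (\<forall>n>0. lphs n (d n) (\<delta> n) (H n)) \<longrightarrow>
      (\<exists>p. polylog p \<and>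
         (\<forall>\<^sub>F n in sequentially. sqrt (real n) \<le> p n * real (d n)))"
    using superpoly_small_query_bound polylog_logsize[of 0 0 1]
    by (intro allI impI exI[of _ "\<lambda>n. 1"]) auto
qed

end
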